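(* Let $\mathrm{EDdegree}(\bar\Gamma_n)$ denote the ED degree of the hypersurface $V(\bar\Gamma_n)\subset\mathbb{C}^{n+1}$ (coordinates $x_0,\dots,x_n$) defined by the homogeneous Hurwitz determinant, and let $\mathrm{EDdegree}(\Gamma_n)$ denote the ED degree of the hypersurface $V(\Gamma_n)\subset\mathbb{C}^n$ (coordinates $x_1,\dots,x_n$) defined by the non-homogeneous Hurwitz determinant. Then the ED degrees of the Hurwitz determinants are as follows: (i) if $n=2m+1$, then $\mathrm{EDdegree}(\Gamma_n)=8m-3$ and $\mathrm{EDdegree}(\bar\Gamma_n)=4m-2$; (ii) if $n=2m$, then $\mathrm{EDdegree}(\Gamma_n)=4m-3$ and $\mathrm{EDdegree}(\bar\Gamma_n)=8m-6$.
   Context: Hurwitz determinants: the $n$th Hurwitz matrix $H_n$ is the $n\times n$ matrix whose $(i,j)$ entry is $x_{2j-i}$, with the convention that the entry is $0$ when $2j-i<0$ or $2j-i>n$. For example $$H_5=\begin{pmatrix} x_1&x_3&x_5&0&0\\ x_0&x_2&x_4&0&0\\ 0&x_1&x_3&x_5&0\\ 0&x_0&x_2&x_4&0\\ 0&0&x_1&x_3&x_5\end{pmatrix}.$$ The homogeneous Hurwitz determinant is $\bar\Gamma_n=\det(H_n)/x_n$, which is the $(n-1)$st leading principal minor of $H_n$, a homogeneous polynomial of degree $n-1$. The non-homogeneous Hurwitz determinant $\Gamma_n$ is obtained from $\bar\Gamma_n$ by setting $x_0=1$. ED degree: on $\mathbb{C}^N$ use the symmetric bilinear form $x\cdot y=\sum_i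 x_iy_i$ (no complex conjugation), and let $\perp$ refer to it. For an affine variety $X\subset\mathbb{C}^N$ with singular locus $X_{\rm sing}$ and $u\in\mathbb{C}^N$, a critical point of $d_u(x)=\sum_i(u_i-x_i)^2$ on $X$ is a point $x\in X\setminus X_{\rm sing}$ with $u-x\perp T_xX$, where $T_xX$ is the tangent space of $X$ at $x$. For all $u$ in a nonempty Zariski open subset of $\mathbb{C}^N$ the number of critical points is finite and constant; this number is $\mathrm{EDdegree}(X)$.
   Formalization: The formulas are claimed for m ≥ 1 (for n = 1 the variety is empty and they would be negative), and the one for EDdegree(Γ̄_n) with n = 2m only for m ≥ 2, since Γ̄_2 = x_1 defines a hyperplane of ED degree 1, not 2. *)

theory Defs
  imports "HOL-Analysis.Analysis" "Jordan_Normal_Form.Determinant"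
begin

section \<open>Affine space, polynomials and hypersurfaces\<close>

text \<open>
  The coordinates of an affine space are indexed by a finite set \<open>I\<close>.  The homogeneous Hurwitz
  determinant lives on the space with \<open>I = {0..n}\<close>, the non-homogeneous one on the space with
  \<open>I = {1..n}\<close>.  A point is a function that vanishes outside \<open>I\<close>.
\<close>

definition affine_space :: "'i set \<Rightarrow> ('i \<Rightarrow> complex) set" where
  "affine_space I = {x. \<forall>i. i \<notin> I \<longrightarrow> x i = 0}"

text \<open>
  Polynomials in the variables \<open>x i\<close>, \<open>i \<in> I\<close>, are represented by their polynomial functions; as
  the complex field is infinite, the two notions agree, and the formal partial
  derivatives are the analytic ones.
\<close>

inductive_set polyfuns :: "'i set \<Rightarrow> (('i \<Rightarrow> complex) \<Rightarrow> complex) set" for I where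
  const: "(\<lambda>x. c) \<in> polyfuns I"
| coord: "i \<in> I \<Longrightarrow> (\<lambda>x. x i) \<in> polyfuns I"
| add: "f \<in> polyfuns I \<Longrightarrow> g \<in> polyfuns I \<Longrightarrow> (\<lambda>x. f x + g x) \<in> polyfuns I"
| mult: "f \<in> polyfuns I \<Longrightarrow> g \<in> polyfuns I \<Longrightarrow> (\<lambda>x. f x * g x) \<in> polyfuns I"

definition partial_deriv :: "'i \<Rightarrow> (('i \<Rightarrow> complex) \<Rightarrow> complex) \<Rightarrow> ('i \<Rightarrow> complex) \<Rightarrow> complex" where
  "partial_deriv i f x = deriv (\<lambda>t. f (x(i := t))) (x i)"

definition zariski_open :: "'i set \<Rightarrow> ('i \<Rightarrow> complex) set \<Rightarrow> bool" where
  "zariski_open I U \<longleftrightarrow> (\<exists>S \<subseteq> polyfuns I. U = {x \<in> affine_space I. \<exists>f\<in>S. f x \<noteq> 0})"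

definition hypersurface :: "'i set \<Rightarrow> (('i \<Rightarrow> complex) \<Rightarrow> complex) \<Rightarrow> ('i \<Rightarrow> complex) set" where
  "hypersurface I f = {x \<in> affine_space I. f x = 0}"

definition vanishing_ideal ::
    "'i set \<Rightarrow> ('i \<Rightarrow> complex) set \<Rightarrow> (('i \<Rightarrow> complex) \<Rightarrow> complex) set" where
  "vanishing_ideal I X = {f \<in> polyfuns I. \<forall>x\<in>X. f x = 0}"


section \<open>Euclidean distance degree of a hypersurface\<close>

definition tangent_space ::
    "'i set \<Rightarrow> ('i \<Rightarrow> complex) set \<Rightarrow> ('i \<Rightarrow> complex) \<Rightarrow> ('i \<Rightarrow> complex) set" where
  "tangent_space I X x =
     {v \<in> affine_space I. \<forall>f \<in> vanishing_ideal I X. (\<Sum>i\<in>I. partial_deriv i f x * v i) = 0}"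

text \<open>
  A point of a variety of codimension \<open>c\<close> is singular iff the Jacobian matrix of the vanishing
  ideal has rank less than \<open>c\<close> there.  For a hypersurface \<open>c = 1\<close>, so that all the gradients vanish.
  The whole (radical) ideal of \<open>X\<close> is used, so the notion depends on the point set \<open>X\<close> only and
  not on the equation that defines it.
\<close>

definition hypersurface_sing :: "'i set \<Rightarrow> ('i \<Rightarrow> complex) set \<Rightarrow> ('i \<Rightarrow> complex) set" where
  "hypersurface_sing I X =
     {x \<in> X. \<forall>f \<in> vanishing_ideal I X. \<forall>i\<in>I. partial_deriv i f x = 0}"

definition bilinear_form :: "'i set \<Rightarrow> ('i \<Rightarrow> complex) \<Rightarrow> ('i \<Rightarrow> complex) \<Rightarrow> complex" where
  "bilinear_form I x y = (\<Sum>i\<in>I. x i * y i)"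

definition critical_points ::
    "'i set \<Rightarrow> ('i \<Rightarrow> complex) set \<Rightarrow> ('i \<Rightarrow> complex) \<Rightarrow> ('i \<Rightarrow> complex) set" where
  "critical_points I X u =
     {x \<in> X - hypersurface_sing I X.
        \<forall>v \<in> tangent_space I X x. bilinear_form I (\<lambda>i. u i - x i) v = 0}"

text \<open>
  \<open>has_EDdegree I X d\<close> says that the ED degree of the hypersurface \<open>X\<close> is well defined and equal
  to \<open>d\<close>; by \<open>has_EDdegree_unique\<close> below there is at most one such \<open>d\<close>.
\<close>

definition has_EDdegree :: "'i set \<Rightarrow> ('i \<Rightarrow> complex) set \<Rightarrow> nat \<Rightarrow> bool" where
  "has_EDdegree I X d \<longleftrightarrow>
     (\<exists>U. zariski_open I U \<and> U \<noteq> {} \<and>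
          (\<forall>u\<in>U. finite (critical_points I X u) \<and> card (critical_points I X u) = d))"

lemma polyfuns_line:
  assumes "f \<in> polyfuns I"
  shows "\<exists>p. \<forall>t. f (\<lambda>i. a i + t * b i) = poly p t"
  using assms
proof induction
  case (const c)
  show ?case by (rule exI[of _ "[:c:]"]) simp
next
  case (coord i)
  show ?case by (rule exI[of _ "[:a i, b i:]"]) simp
next
  case (add f g)
  then obtain p q where "\<forall>t. f (\<lambda>i. a i + t * b i) = poly p t" "\<forall>t. g (\<lambda>i. a i + t * b i) = poly q t"
    by blast
  then show ?case by (intro exI[of _ "p + q"]) simp
next
  case (mult f g)
  then obtain p q where "\<forall>t. f (\<lambda>i. a i + t * b i) = poly p t" "\<forall>t. g (\<lambda>i. a i + t * b i) = poly q t"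
    by blast
  then show ?case by (intro exI[of _ "p * q"]) simp
qed

lemma zariski_open_Int_nonempty:
  assumes "zariski_open I U" "zariski_open I V" "U \<noteq> {}" "V \<noteq> {}"
  shows "U \<inter> V \<noteq> {}"
proof -
  obtain S where S: "S \<subseteq> polyfuns I" "U = {x \<in> affine_space I. \<exists>f\<in>S. f x \<noteq> 0}"
    using assms(1) unfolding zariski_open_def by blast
  obtain T where T: "T \<subseteq> polyfuns I" "V = {x \<in> affine_space I. \<exists>f\<in>T. f x \<noteq> 0}"
    using assms(2) unfolding zariski_open_def by blast
  obtain u f where u: "u \<in> affine_space I" "f \<in> S" "f u \<noteq> 0"
    using assms(3) S(2) by blast
  obtain v g where v: "v \<in> affine_space I" "g \<in> T" "g v \<noteq> 0"
    using assms(4) T(2) by blast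
  define b where "b = (\<lambda>i. v i - u i)"
  obtain p where p: "\<And>t. f (\<lambda>i. u i + t * b i) = poly p t"
    using polyfuns_line[of f I u b] u(2) S(1) by blast
  obtain q where q: "\<And>t. g (\<lambda>i. u i + t * b i) = poly q t"
    using polyfuns_line[of g I u b] v(2) T(1) by blast
  have "poly p 0 \<noteq> 0" "poly q 1 \<noteq> 0"
    using u(3) v(3) p[of 0] q[of 1] by (simp_all add: b_def)
  then have "p * q \<noteq> 0" by auto
  then have "finite {t. poly (p * q) t = 0}" by (rule poly_roots_finite)
  then obtain t where "poly (p * q) t \<noteq> 0"
    using infinite_UNIV_char_0[where 'a = complex] by (metis (mono_tags, lifting) UNIV_eq_I mem_Collect_eq)
  then have t: "f (\<lambda>i. u i + t * b i) \<noteq> 0" "g (\<lambda>i. u i + t * b i) \<noteq> 0"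
    using p q by auto
  have "(\<lambda>i. u i + t * b i) \<in> affine_space I"
    using u(1) v(1) by (auto simp: affine_space_def b_def)
  then have "(\<lambda>i. u i + t * b i) \<in> U \<inter> V"
    using t u(2) v(2) S(2) T(2) by blast
  then show ?thesis by blast
qed

lemma has_EDdegree_unique:
  assumes "has_EDdegree I X d" "has_EDdegree I X e"
  shows "d = e"
proof -
  obtain U where U: "zariski_open I U" "U \<noteq> {}" "\<forall>u\<in>U. card (critical_points I X u) = d"
    using assms(1) unfolding has_EDdegree_def by blast
  obtain V where V: "zariski_open I V" "V \<noteq> {}" "\<forall>u\<in>V. card (critical_points I X u) = e"
    using assms(2) unfolding has_EDdegree_def by blast
  have "U \<inter> V \<noteq> {}" using zariski_open_Int_nonempty U(1,2) V(1,2) by blast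
  then show ?thesis using U(3) V(3) by auto
qed


section \<open>Hurwitz determinants\<close>

text \<open>
  Matrices of the library are indexed from \<open>0\<close>, whereas \<open>hurwitz_entry n x i j\<close> is the entry in
  row \<open>i\<close> and column \<open>j\<close> counted from \<open>1\<close>.
\<close>

definition hurwitz_entry :: "nat \<Rightarrow> (nat \<Rightarrow> complex) \<Rightarrow> nat \<Rightarrow> nat \<Rightarrow> complex" where
  "hurwitz_entry n x i j = (if i \<le> 2 * j \<and> 2 * j - i \<le> n then x (2 * j - i) else 0)"

definition hurwitz_mat :: "nat \<Rightarrow> (nat \<Rightarrow> complex) \<Rightarrow> complex mat" where
  "hurwitz_mat n x = Matrix.mat n n (\<lambda>(i, j). hurwitz_entry n x (i + 1) (j + 1))"

text \<open>
  The quotient of \<open>det (hurwitz_mat n x)\<close> by \<open>x n\<close> is a quotient of polynomials, not of values, and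
  is therefore defined as the leading principal minor of size \<open>n - 1\<close>; see \<open>det_hurwitz_mat\<close>.
\<close>

definition hurwitz_Gamma_bar :: "nat \<Rightarrow> (nat \<Rightarrow> complex) \<Rightarrow> complex" where
  "hurwitz_Gamma_bar n x =
     Determinant.det (Matrix.mat (n - 1) (n - 1) (\<lambda>(i, j). hurwitz_mat n x $$ (i, j)))"

definition hurwitz_Gamma :: "nat \<Rightarrow> (nat \<Rightarrow> complex) \<Rightarrow> complex" where
  "hurwitz_Gamma n x = hurwitz_Gamma_bar n (x(0 := 1))"

lemma det_hurwitz_mat:
  assumes "n \<ge> 1"
  shows "Determinant.det (hurwitz_mat n x) = x n * hurwitz_Gamma_bar n x"
proof -
  let ?H = "hurwitz_mat n x"
  have carrier: "?H \<in> carrier_mat n n" by (simp add: hurwitz_mat_def)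
  have last: "?H $$ (i, n - 1) = (if i = n - 1 then x n else 0)" if "i < n" for i
    using that assms by (auto simp: hurwitz_mat_def hurwitz_entry_def intro!: arg_cong[of _ _ x])
  have del: "mat_delete ?H (n - 1) (n - 1) =
      Matrix.mat (n - 1) (n - 1) (\<lambda>(i, j). ?H $$ (i, j))"
    by (rule eq_matI) (auto simp: mat_delete_def hurwitz_mat_def)
  have "Determinant.det ?H = (\<Sum>i<n. ?H $$ (i, n - 1) * cofactor ?H i (n - 1))"
    using assms by (intro laplace_expansion_column[OF carrier]) simp
  also have "\<dots> = (\<Sum>i<n. if i = n - 1 then x n * cofactor ?H (n - 1) (n - 1) else 0)"
    by (rule sum.cong) (auto simp: last simp del: One_nat_def)
  also have "\<dots> = x n * cofactor ?H (n - 1) (n - 1)" using assms by simp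
  also have "\<dots> = x n * hurwitz_Gamma_bar n x"
    unfolding cofactor_def del hurwitz_Gamma_bar_def by (simp flip: mult_2)
  finally show ?thesis .
qed

end

theory Submission
  imports Defs "HOL-Computational_Algebra.Field_as_Ring"
    "HOL-Computational_Algebra.Fundamental_Theorem_Algebra"
begin

text \<open>
  Read the even-indexed coordinates of a point \<open>x\<close> as the coefficients of a polynomial of degree
  \<open>a = n div 2\<close> and the odd-indexed ones as those of a polynomial of degree \<open>b = (n - 1) div 2\<close>.  Up to
  the order of its rows, the Hurwitz minor is the Sylvester matrix of these two polynomials, so the
  hypersurface consists of the points whose even and odd part have a common root \<open>w\<close> on the
  projective line (\<open>hurwitz_Gamma_bar_eq_0_iff\<close>).  It is therefore swept out by affine-linear
  spaces \<open>L w\<close> of codimension two, with normal vectors \<open>even_powers w = (w ^ k)\<close> in the even coordinates and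
  \<open>odd_powers w = (w ^ k)\<close> in the odd ones.

  Let \<open>P\<close> and \<open>Q\<close> be the two parts of a data point \<open>u\<close>, and let \<open>A w\<close> and \<open>B w\<close> be the products of the
  two normal vectors with themselves.  The point of \<open>L w\<close> critical for the distance to \<open>u\<close> is the
  foot of the perpendicular, at squared distance \<open>P\<^sup>2 / A + Q\<^sup>2 / B\<close>, and it is critical on the whole
  hypersurface iff the derivative of this rational function of \<open>w\<close> vanishes.  The ED degree is thus
  the degree of the numerator of the derivative in lowest terms.  With \<open>A\<close> and \<open>B\<close> equal
  (homogeneous, \<open>n\<close> odd), coprime (homogeneous, \<open>n\<close> even), \<open>A = w\<^sup>2 B\<close> (non-homogeneous, \<open>n\<close> even), or
  \<open>A / w\<^sup>2\<close> and \<open>B\<close> coprime (non-homogeneous, \<open>n\<close> odd), different factors cancel, which produces the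
  four numbers.

  Two things have to be shown.  For fixed \<open>u\<close>, the critical points correspond to the roots of the
  numerator (\<open>critical_points_eq\<close>), provided that the feet of the perpendiculars are smooth points.  One
  direction uses curves in the hypersurface along which the common root moves
  (\<open>tangent_vector_finite\<close>, \<open>tangent_vector_infinity\<close>), the other one the gradient of the determinant
  (\<open>hurwitz_Gamma_bar_derivative_zero\<close>).  For generic \<open>u\<close>, the numerator has full degree and simple
  roots, and the feet are smooth (\<open>generic_point\<close>).  All these conditions say that certain polynomials in \<open>w\<close>,
  with coefficients polynomial in \<open>u\<close>, have no common root; the Hurwitz determinant itself,
  in its role as a resultant, shows that they are Zariski open (\<open>generic_no_common_root\<close>).  That they
  can be satisfied is seen on the points with \<open>P = (1 + t) ^ a\<close> and \<open>Q = s (\<kappa> + t)\<close>, for which the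
  numerator is a pencil \<open>F + s\<^sup>2 G\<close>; for almost all \<open>\<kappa>\<close> it has no base points, so that almost all of
  its members have simple roots (\<open>pencil_squarefree\<close>).  A \<open>Q\<close> of this form requires \<open>b \<ge> 1\<close>, that is
  \<open>n \<ge> 3\<close>; the non-homogeneous hypersurface for \<open>n = 2\<close> is a line.
\<close>

section \<open>The Hurwitz determinant as a resultant\<close>

abbreviation common_root :: "complex poly \<Rightarrow> complex poly \<Rightarrow> complex \<Rightarrow> bool" where
  "common_root p q w \<equiv> poly p w = 0 \<and> poly q w = 0"

definition even_part :: "nat \<Rightarrow> (nat \<Rightarrow> complex) \<Rightarrow> complex poly" where
  "even_part n x = (\<Sum>k\<le>n div 2. monom (x (2 * k)) k)"

definition odd_part :: "nat \<Rightarrow> (nat \<Rightarrow> complex) \<Rightarrow> complex poly" where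
  "odd_part n x = (\<Sum>k\<le>(n - 1) div 2. monom (x (2 * k + 1)) k)"

lemma coeff_even_part: "coeff (even_part n x) k = (if k \<le> n div 2 then x (2 * k) else 0)"
  by (auto simp: even_part_def coeff_sum)

lemma coeff_odd_part: "coeff (odd_part n x) k = (if k \<le> (n - 1) div 2 then x (2 * k + 1) else 0)"
  by (auto simp: odd_part_def coeff_sum)

lemma degree_even_part: "degree (even_part n x) \<le> n div 2"
  by (rule degree_le) (simp add: coeff_even_part)

lemma degree_odd_part: "degree (odd_part n x) \<le> (n - 1) div 2"
  by (rule degree_le) (simp add: coeff_odd_part)

lemma even_part_combination:
  "even_part n (\<lambda>i. c * x i + d * y i) = Polynomial.smult c (even_part n x) + Polynomial.smult d (even_part n y)"
  by (rule poly_eqI) (simp add: coeff_even_part)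

lemma odd_part_combination:
  "odd_part n (\<lambda>i. c * x i + d * y i) = Polynomial.smult c (odd_part n x) + Polynomial.smult d (odd_part n y)"
  by (rule poly_eqI) (simp add: coeff_odd_part)

lemma poly_even_part: "poly (even_part n x) w = (\<Sum>k\<le>n div 2. x (2 * k) * w ^ k)"
  by (simp add: even_part_def poly_sum poly_monom)

lemma poly_odd_part: "poly (odd_part n x) w = (\<Sum>k\<le>(n - 1) div 2. x (2 * k + 1) * w ^ k)"
  by (simp add: odd_part_def poly_sum poly_monom)

definition sylvester_row :: "nat \<Rightarrow> (nat \<Rightarrow> complex) \<Rightarrow> nat \<Rightarrow> complex poly" where
  "sylvester_row n x i = monom 1 (i div 2) * (if even i then odd_part n x else even_part n x)"

definition hurwitz_minor :: "nat \<Rightarrow> (nat \<Rightarrow> complex) \<Rightarrow> complex mat" where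
  "hurwitz_minor n x = Matrix.mat (n - 1) (n - 1) (\<lambda>(i, j). coeff (sylvester_row n x i) j)"

lemma hurwitz_minor_carrier: "hurwitz_minor n x \<in> carrier_mat (n - 1) (n - 1)"
  by (simp add: hurwitz_minor_def)

text \<open>Up to the order of the rows, the leading principal minor is the Sylvester matrix of the even
  and the odd part, because each row is the coefficient sequence of one of the two, shifted.\<close>
lemma hurwitz_Gamma_bar_eq_det: "hurwitz_Gamma_bar n x = Determinant.det (hurwitz_minor n x)"
proof -
  have "hurwitz_mat n x $$ (i, j) = coeff (sylvester_row n x i) j"
    if ij: "i < n - 1" "j < n - 1" for i j
  proof (cases "even i")
    case True
    then obtain k where k: "i = 2 * k" by auto
    have "2 * (j + 1) - (i + 1) = 2 * (j - k) + 1" if "k \<le> j"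
      using that k by auto
    then show ?thesis
      using ij k by (auto simp: hurwitz_mat_def hurwitz_entry_def sylvester_row_def
          coeff_monom_mult coeff_odd_part)
  next
    case False
    then obtain k where k: "i = 2 * k + 1" by (auto elim: oddE)
    have "2 * (j + 1) - (i + 1) = 2 * (j - k)" if "k \<le> j"
      using that k by auto
    then show ?thesis
      using ij k by (auto simp: hurwitz_mat_def hurwitz_entry_def sylvester_row_def
          coeff_monom_mult coeff_even_part)
  qed
  then show ?thesis
    unfolding hurwitz_Gamma_bar_def hurwitz_minor_def
    by (intro arg_cong[of _ _ Determinant.det] eq_matI) auto
qed

lemma degree_sylvester_row:
  assumes "i < n - 1"
  shows "degree (sylvester_row n x i) < n - 1"
proof -
  have "degree (sylvester_row n x i) \<le>
      i div 2 + (if even i then (n - 1) div 2 else n div 2)"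
    unfolding sylvester_row_def
    using degree_mult_le[of "monom 1 (i div 2)"] degree_even_part[of n x] degree_odd_part[of n x]
    by (smt (verit, best) add_mono_thms_linordered_semiring(1) degree_monom_le le_trans)
  also have "\<dots> < n - 1" using assms by (auto elim!: evenE oddE)
  finally show ?thesis .
qed

lemma poly_eq_sum_lessThan:
  fixes p :: "complex poly"
  assumes "degree p < r"
  shows "poly p w = (\<Sum>j<r. coeff p j * w ^ j)"
  unfolding poly_altdef using assms by (intro sum.mono_neutral_left) (auto simp: coeff_eq_0)

lemma det_zero_left_kernel:
  fixes M :: "complex mat"
  assumes "M \<in> carrier_mat r r" "Determinant.det M = 0"
  obtains h where "\<exists>i<r. h i \<noteq> 0" "\<And>j. j < r \<Longrightarrow> (\<Sum>i<r. h i * M $$ (i, j)) = 0"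
proof -
  have T: "transpose_mat M \<in> carrier_mat r r" using assms(1) by simp
  have "Determinant.det (transpose_mat M) = 0" using assms det_transpose by metis
  then obtain v where v: "v \<in> carrier_vec r" "v \<noteq> 0\<^sub>v r" "transpose_mat M *\<^sub>v v = 0\<^sub>v r"
    using det_0_iff_vec_prod_zero_field[OF T] by blast
  have "\<exists>i<r. vec_index v i \<noteq> 0"
    using v(1,2) by (metis carrier_vecD eq_vecI index_zero_vec(1,2))
  moreover have "(\<Sum>i<r. vec_index v i * M $$ (i, j)) = 0" if "j < r" for j
  proof -
    have "vec_index (transpose_mat M *\<^sub>v v) j = 0" using v(3) that by simp
    then show ?thesis
      using that v(1) assms(1)
      by (auto simp: scalar_prod_def atLeast0LessThan mult.commute intro!: sum.cong)
  qed
  ultimately show thesis by (rule that)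
qed

lemma det_zero_if_right_kernel:
  fixes M :: "complex mat"
  assumes M: "M \<in> carrier_mat r r"
    and z: "\<exists>j<r. z j \<noteq> 0" "\<And>i. i < r \<Longrightarrow> (\<Sum>j<r. M $$ (i, j) * z j) = 0"
  shows "Determinant.det M = 0"
proof -
  have "Matrix.vec r z \<noteq> 0\<^sub>v r" using z(1) by (metis index_vec index_zero_vec(1))
  moreover have "M *\<^sub>v Matrix.vec r z = 0\<^sub>v r"
    using M z(2) by (intro eq_vecI) (auto simp: scalar_prod_def atLeast0LessThan)
  ultimately show ?thesis
    using det_0_iff_vec_prod_zero_field[OF M] vec_carrier by blast
qed

text \<open>A left kernel vector is a syzygy \<open>F * even_part + G * odd_part = 0\<close> of small degree: the
  multipliers are assembled from the entries that belong to the rows of either kind.\<close>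
lemma left_kernel_syzygy:
  assumes h: "\<exists>i<n - 1. h i \<noteq> 0"
    and ker: "\<And>j. j < n - 1 \<Longrightarrow> (\<Sum>i<n - 1. h i * coeff (sylvester_row n x i) j) = 0"
  obtains F G where "F * even_part n x + G * odd_part n x = 0" "F \<noteq> 0 \<or> G \<noteq> 0"
    "F = 0 \<or> degree F < (n - 1) div 2" "G = 0 \<or> degree G < n div 2"
    "\<forall>v. (\<Sum>i<n - 1. Polynomial.smult (h i) (sylvester_row n v i)) = F * even_part n v + G * odd_part n v"
proof -
  define F where "F = (\<Sum>i\<in>{i. i < n - 1 \<and> odd i}. monom (h i) (i div 2))"
  define G where "G = (\<Sum>i\<in>{i. i < n - 1 \<and> even i}. monom (h i) (i div 2))"
  have FG: "(\<Sum>i<n - 1. Polynomial.smult (h i) (sylvester_row n v i)) = F * even_part n v + G * odd_part n v"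
    for v
  proof -
    have "(\<Sum>i<n - 1. Polynomial.smult (h i) (sylvester_row n v i)) =
       (\<Sum>i\<in>{i. i < n - 1 \<and> odd i} \<union> {i. i < n - 1 \<and> even i}. Polynomial.smult (h i) (sylvester_row n v i))"
      by (rule sum.cong) auto
    also have "\<dots> = (\<Sum>i\<in>{i. i < n - 1 \<and> odd i}. Polynomial.smult (h i) (sylvester_row n v i)) +
       (\<Sum>i\<in>{i. i < n - 1 \<and> even i}. Polynomial.smult (h i) (sylvester_row n v i))"
      by (rule sum.union_disjoint) auto
    also have "\<dots> = F * even_part n v + G * odd_part n v"
      unfolding F_def G_def sum_distrib_right
      by (intro arg_cong2[of _ _ _ _ "(+)"] sum.cong)
        (auto simp: sylvester_row_def smult_monom simp flip: mult_smult_left)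
    finally show ?thesis .
  qed
  have coeff_F: "coeff F k = (if 2 * k + 1 < n - 1 then h (2 * k + 1) else 0)" for k
  proof -
    have "coeff F k = (\<Sum>i\<in>{i. i < n - 1 \<and> odd i}. if i = 2 * k + 1 then h i else 0)"
      unfolding F_def coeff_sum by (rule sum.cong) (auto elim!: oddE)
    then show ?thesis by simp
  qed
  have coeff_G: "coeff G k = (if 2 * k < n - 1 then h (2 * k) else 0)" for k
  proof -
    have "coeff G k = (\<Sum>i\<in>{i. i < n - 1 \<and> even i}. if i = 2 * k then h i else 0)"
      unfolding G_def coeff_sum by (rule sum.cong) (auto elim!: evenE)
    then show ?thesis by simp
  qed
  have zero: "F * even_part n x + G * odd_part n x = 0"
  proof (rule poly_eqI)
    fix j
    show "coeff (F * even_part n x + G * odd_part n x) j = coeff 0 j"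
    proof (cases "j < n - 1")
      case True
      then show ?thesis using ker[OF True] by (simp add: coeff_sum flip: FG)
    next
      case False
      then have "coeff (sylvester_row n x i) j = 0" if "i < n - 1" for i
        using degree_sylvester_row[OF that, of x] by (intro coeff_eq_0) simp
      then show ?thesis by (simp add: coeff_sum flip: FG)
    qed
  qed
  have nz: "F \<noteq> 0 \<or> G \<noteq> 0"
  proof -
    obtain i where i: "i < n - 1" "h i \<noteq> 0" using h by blast
    show ?thesis
    proof (cases "even i")
      case True
      then have "coeff G (i div 2) \<noteq> 0" using i by (simp add: coeff_G)
      then show ?thesis by auto
    next
      case False
      then have "coeff F (i div 2) \<noteq> 0" using i by (simp add: coeff_F)
      then show ?thesis by auto
    qed
  qed
  have "F = 0 \<or> degree F < (n - 1) div 2"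
  proof (rule disjCI)
    assume "\<not> degree F < (n - 1) div 2"
    then have "\<not> 2 * degree F + 1 < n - 1" by auto
    then show "F = 0" using coeff_F[of "degree F"] by (metis leading_coeff_0_iff)
  qed
  moreover have "G = 0 \<or> degree G < n div 2"
  proof (rule disjCI)
    assume "\<not> degree G < n div 2"
    then have "\<not> 2 * degree G < n - 1" by auto
    then show "G = 0" using coeff_G[of "degree G"] by (metis leading_coeff_0_iff)
  qed
  ultimately show thesis using that zero nz FG by blast
qed

lemma coprime_complex_poly:
  fixes p q :: "complex poly"
  assumes "p \<noteq> 0 \<or> q \<noteq> 0" "\<And>w. \<not> common_root p q w"
  shows "coprime p q"
proof (rule coprimeI)
  fix d assume d: "d dvd p" "d dvd q"
  have "d \<noteq> 0" using d assms(1) by auto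
  moreover have "degree d = 0"
  proof (rule ccontr)
    assume "degree d \<noteq> 0"
    then obtain w where "poly d w = 0"
      using fundamental_theorem_of_algebra[of d] by (auto simp: constant_degree)
    then show False using d assms(2)[of w] by (auto elim!: dvdE)
  qed
  ultimately show "is_unit d" by (simp add: is_unit_iff_degree)
qed

lemma syzygy_trivial:
  fixes p q F G :: "complex poly"
  assumes "F * p + G * q = 0" "\<And>w. \<not> common_root p q w"
    and "coeff p a \<noteq> 0" "G = 0 \<or> degree G < a" "degree p \<le> a"
  shows "F = 0 \<and> G = 0"
proof -
  have p: "p \<noteq> 0" "degree p = a" using assms(3,5) le_degree[of p a] by auto
  then have cop: "coprime p q" using coprime_complex_poly assms(2) by blast
  have "G * q = p * (- F)" using assms(1) by (simp add: eq_neg_iff_add_eq_0 mult.commute add.commute)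
  then have "p dvd G * q" by (metis dvd_triv_left)
  then have "p dvd G" using coprime_dvd_mult_left_iff[OF cop] by blast
  then have "G = 0" using assms(4) p(2) dvd_imp_degree_le[of p G] by (metis leD)
  then show ?thesis using assms(1) p by auto
qed

text \<open>The vanishing locus consists of the pairs of polynomials with a common root on the projective
  line; the point at infinity is a root of a polynomial whose formal leading coefficient vanishes.\<close>
theorem hurwitz_Gamma_bar_eq_0_iff:
  assumes n: "n \<ge> 2"
  shows "hurwitz_Gamma_bar n x = 0 \<longleftrightarrow>
     (\<exists>w. common_root (even_part n x) (odd_part n x) w) \<or>
     (x (2 * (n div 2)) = 0 \<and> x (2 * ((n - 1) div 2) + 1) = 0)"
    (is "_ \<longleftrightarrow> ?R")
proof
  let ?a = "n div 2" and ?b = "(n - 1) div 2"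
  assume "hurwitz_Gamma_bar n x = 0"
  then have "Determinant.det (hurwitz_minor n x) = 0" by (simp add: hurwitz_Gamma_bar_eq_det)
  then obtain h where h: "\<exists>i<n - 1. h i \<noteq> 0"
    "\<And>j. j < n - 1 \<Longrightarrow> (\<Sum>i<n - 1. h i * hurwitz_minor n x $$ (i, j)) = 0"
    using det_zero_left_kernel[OF hurwitz_minor_carrier] by blast
  have ker: "(\<Sum>i<n - 1. h i * coeff (sylvester_row n x i) j) = 0" if "j < n - 1" for j
    using h(2)[OF that] that by (simp add: hurwitz_minor_def)
  obtain F G where FG: "F * even_part n x + G * odd_part n x = 0" "F \<noteq> 0 \<or> G \<noteq> 0"
    "F = 0 \<or> degree F < ?b" "G = 0 \<or> degree G < ?a"
    by (rule left_kernel_syzygy[OF h(1) ker])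
  show ?R
  proof (rule ccontr)
    assume R: "\<not> ?R"
    then consider "coeff (even_part n x) ?a \<noteq> 0" | "coeff (odd_part n x) ?b \<noteq> 0"
      by (auto simp: coeff_even_part coeff_odd_part)
    then show False
    proof cases
      case 1
      from syzygy_trivial[OF FG(1) _ this FG(4) degree_even_part] R FG(2) show False by auto
    next
      case 2
      have "G * odd_part n x + F * even_part n x = 0" using FG(1) by (simp add: add.commute)
      from syzygy_trivial[OF this _ 2 FG(3) degree_odd_part] R FG(2) show False by auto
    qed
  qed
next
  let ?a = "n div 2" and ?b = "(n - 1) div 2"
  assume ?R
  then consider (fin) w where "common_root (even_part n x) (odd_part n x) w"
    | (inf) "x (2 * ?a) = 0" "x (2 * ?b + 1) = 0" by blast
  then have "Determinant.det (hurwitz_minor n x) = 0"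
  proof cases
    case fin
    show ?thesis
    proof (rule det_zero_if_right_kernel[OF hurwitz_minor_carrier])
      show "\<exists>j<n - 1. w ^ j \<noteq> 0" using n by (intro exI[of _ 0]) auto
      fix i assume i: "i < n - 1"
      have "(\<Sum>j<n - 1. hurwitz_minor n x $$ (i, j) * w ^ j) =
          (\<Sum>j<n - 1. coeff (sylvester_row n x i) j * w ^ j)"
        using i by (simp add: hurwitz_minor_def)
      also have "\<dots> = poly (sylvester_row n x i) w"
        by (rule poly_eq_sum_lessThan[OF degree_sylvester_row[OF i], symmetric])
      also have "\<dots> = 0" using fin by (simp add: sylvester_row_def)
      finally show "(\<Sum>j<n - 1. hurwitz_minor n x $$ (i, j) * w ^ j) = 0" .
    qed
  next
    case inf
    show ?thesis
    proof (rule det_zero_if_right_kernel[OF hurwitz_minor_carrier])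
      let ?z = "\<lambda>j. if j = n - 2 then 1 else 0 :: complex"
      show "\<exists>j<n - 1. ?z j \<noteq> 0" using n by (intro exI[of _ "n - 2"]) auto
      fix i assume i: "i < n - 1"
      have "coeff (sylvester_row n x i) (n - 2) = 0"
      proof (cases "even i")
        case True
        then obtain k where k: "i = 2 * k" by auto
        have "n - 2 - k = ?b \<or> n - 2 - k > ?b" using i k by auto
        then show ?thesis using inf k by (auto simp: sylvester_row_def coeff_monom_mult coeff_odd_part)
      next
        case False
        then obtain k where k: "i = 2 * k + 1" by (auto elim: oddE)
        have "n - 2 - k = ?a \<or> n - 2 - k > ?a" using i k by auto
        then show ?thesis using inf k by (auto simp: sylvester_row_def coeff_monom_mult coeff_even_part)
      qed
      then show "(\<Sum>j<n - 1. hurwitz_minor n x $$ (i, j) * ?z j) = 0"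
        using i n by (simp add: hurwitz_minor_def if_distrib cong: if_cong)
    qed
  qed
  then show "hurwitz_Gamma_bar n x = 0" by (simp add: hurwitz_Gamma_bar_eq_det)
qed

text \<open>Any two polynomials of the same formal degree are the even and the odd part of a sequence, so that
  the Hurwitz determinants contain all these resultants.\<close>
definition poly_resultant :: "nat \<Rightarrow> complex poly \<Rightarrow> complex poly \<Rightarrow> complex" where
  "poly_resultant D p q =
     hurwitz_Gamma_bar (2 * D + 1) (\<lambda>i. if even i then coeff p (i div 2) else coeff q (i div 2))"

lemma poly_resultant_eq_0_iff:
  assumes "D \<ge> 1" "degree p \<le> D" "degree q \<le> D"
  shows "poly_resultant D p q = 0 \<longleftrightarrow> (\<exists>w. common_root p q w) \<or> (coeff p D = 0 \<and> coeff q D = 0)"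
proof -
  let ?x = "\<lambda>i. if even i then coeff p (i div 2) else coeff q (i div 2)"
  have "even_part (2 * D + 1) ?x = p" "odd_part (2 * D + 1) ?x = q"
    using assms by (auto intro!: poly_eqI simp: coeff_even_part coeff_odd_part coeff_eq_0)
  then show ?thesis
    unfolding poly_resultant_def using assms(1) by (subst hurwitz_Gamma_bar_eq_0_iff) auto
qed

section \<open>Polynomial functions and families of polynomials\<close>

lemma polyfuns_sum:
  assumes "\<And>k. k \<in> K \<Longrightarrow> f k \<in> polyfuns I"
  shows "(\<lambda>x. \<Sum>k\<in>K. f k x) \<in> polyfuns I"
  using assms by (induction K rule: infinite_finite_induct) (auto intro: polyfuns.intros)

lemma polyfuns_prod:
  assumes "\<And>k. k \<in> K \<Longrightarrow> f k \<in> polyfuns I"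
  shows "(\<lambda>x. \<Prod>k\<in>K. f k x) \<in> polyfuns I"
  using assms by (induction K rule: infinite_finite_induct) (auto intro: polyfuns.intros)

lemma polyfuns_if:
  assumes "P \<Longrightarrow> f \<in> polyfuns I" "\<not> P \<Longrightarrow> g \<in> polyfuns I"
  shows "(\<lambda>x. if P then f x else g x) \<in> polyfuns I"
  using assms by (cases P) auto

lemma polyfuns_compose:
  assumes "g \<in> polyfuns J" "\<And>j. j \<in> J \<Longrightarrow> (\<lambda>u. c j u) \<in> polyfuns I"
  shows "(\<lambda>u. g (\<lambda>j. c j u)) \<in> polyfuns I"
  using assms(1) by induction (auto intro: polyfuns.intros assms(2))

lemma hurwitz_Gamma_bar_polyfuns:
  assumes "n \<ge> 1"
  shows "hurwitz_Gamma_bar n \<in> polyfuns {0..n}"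
proof -
  have "(\<lambda>x. coeff (sylvester_row n x i) j) \<in> polyfuns {0..n}" for i j
  proof -
    have "coeff (sylvester_row n x i) j =
        (if j < i div 2 then 0
         else if even i then (if j - i div 2 \<le> (n - 1) div 2 then x (2 * (j - i div 2) + 1) else 0)
         else (if j - i div 2 \<le> n div 2 then x (2 * (j - i div 2)) else 0))" for x
      by (simp add: sylvester_row_def coeff_monom_mult coeff_even_part coeff_odd_part)
    then show ?thesis
      using assms by (simp only:) (intro polyfuns_if polyfuns.const polyfuns.coord; auto)
  qed
  then have "(\<lambda>x. \<Sum>p\<in>{p. p permutes {0..<n - 1}}. signof p *
      (\<Prod>i\<in>{0..<n - 1}. coeff (sylvester_row n x i) (p i))) \<in> polyfuns {0..n}"
    by (intro polyfuns_sum polyfuns_prod polyfuns.mult polyfuns.const)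
  moreover have "(\<lambda>x. \<Sum>p\<in>{p. p permutes {0..<n - 1}}. signof p *
      (\<Prod>i\<in>{0..<n - 1}. coeff (sylvester_row n x i) (p i))) = hurwitz_Gamma_bar n"
  proof
    fix x
    have "hurwitz_minor n x $$ (i, p i) = coeff (sylvester_row n x i) (p i)"
      if "p permutes {0..<n - 1}" "i \<in> {0..<n - 1}" for p i
      using that permutes_in_image[OF that(1), of i] by (simp add: hurwitz_minor_def)
    then show "(\<Sum>p\<in>{p. p permutes {0..<n - 1}}. signof p *
      (\<Prod>i\<in>{0..<n - 1}. coeff (sylvester_row n x i) (p i))) = hurwitz_Gamma_bar n x"
      unfolding hurwitz_Gamma_bar_eq_det det_def'[OF hurwitz_minor_carrier]
      by (intro sum.cong refl arg_cong2[of _ _ _ _ "(*)"] prod.cong) auto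
  qed
  ultimately show ?thesis by simp
qed

lemma partial_deriv_has_derivative:
  assumes "f \<in> polyfuns I"
  shows "((\<lambda>t. f (x(i := t))) has_field_derivative partial_deriv i f x) (at (x i))"
proof -
  have "(\<lambda>t. f (x(i := t))) field_differentiable (at z)" for z
    using assms
  proof induction
    case (coord j)
    show ?case by (cases "i = j") auto
  qed (auto intro: field_differentiable_add field_differentiable_mult)
  then show ?thesis
    unfolding partial_deriv_def using field_differentiable_derivI by blast
qed

lemma partial_deriv_add:
  assumes "f \<in> polyfuns I" "g \<in> polyfuns I"
  shows "partial_deriv i (\<lambda>x. f x + g x) x = partial_deriv i f x + partial_deriv i g x"
  unfolding partial_deriv_def[of i "\<lambda>x. f x + g x"]
  by (intro DERIV_imp_deriv DERIV_add partial_deriv_has_derivative[OF assms(1)]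
      partial_deriv_has_derivative[OF assms(2)])

lemma partial_deriv_mult:
  assumes "f \<in> polyfuns I" "g \<in> polyfuns I"
  shows "partial_deriv i (\<lambda>x. f x * g x) x = partial_deriv i f x * g x + f x * partial_deriv i g x"
  unfolding partial_deriv_def[of i "\<lambda>x. f x * g x"]
  using DERIV_mult[OF partial_deriv_has_derivative[OF assms(1), of x i]
      partial_deriv_has_derivative[OF assms(2), of x i]]
  by (intro DERIV_imp_deriv) (simp add: algebra_simps)

lemma polyfuns_chain_rule:
  assumes f: "f \<in> polyfuns I" and I: "finite I"
    and c: "\<And>i. i \<in> I \<Longrightarrow> ((\<lambda>s. c s i) has_field_derivative v i) (at t)"
  shows "((\<lambda>s. f (c s)) has_field_derivative (\<Sum>i\<in>I. partial_deriv i f (c t) * v i)) (at t)"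
  using f
proof induction
  case (const k)
  show ?case by (simp add: partial_deriv_def)
next
  case (coord j)
  have "partial_deriv i (\<lambda>x. x j) (c t) = (if i = j then 1 else 0)" for i
    unfolding partial_deriv_def by (cases "i = j") auto
  then have "(\<Sum>i\<in>I. partial_deriv i (\<lambda>x. x j) (c t) * v i) = (\<Sum>i\<in>I. if i = j then v i else 0)"
    by (intro sum.cong) auto
  then show ?case using coord I c by simp
next
  case (add f g)
  then show ?case
    using DERIV_add[OF add.IH]
    by (simp add: partial_deriv_add[OF add.hyps] algebra_simps sum.distrib)
next
  case (mult f g)
  have "(\<Sum>i\<in>I. partial_deriv i (\<lambda>x. f x * g x) (c t) * v i) =
      (\<Sum>i\<in>I. partial_deriv i f (c t) * v i) * g (c t) + (\<Sum>i\<in>I. partial_deriv i g (c t) * v i) * f (c t)"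
    by (simp add: partial_deriv_mult[OF mult.hyps] algebra_simps sum.distrib sum_distrib_left)
  then show ?case using DERIV_mult[OF mult.IH] by simp
qed

text \<open>A polynomial in one variable \<open>w\<close> whose coefficients are polynomial functions of a parameter.
  The degree bound makes it a polynomial in the parameter and \<open>w\<close> together.\<close>
definition poly_family :: "'i set \<Rightarrow> (('i \<Rightarrow> complex) \<Rightarrow> complex poly) \<Rightarrow> bool" where
  "poly_family I F \<longleftrightarrow>
     (\<forall>k. (\<lambda>u. coeff (F u) k) \<in> polyfuns I) \<and> (\<exists>D. \<forall>u. degree (F u) \<le> D)"

lemma poly_family_const: "poly_family I (\<lambda>u. p)"
  by (auto simp: poly_family_def intro: polyfuns.const)

lemma poly_family_monom: "f \<in> polyfuns I \<Longrightarrow> poly_family I (\<lambda>u. monom (f u) k)"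
  unfolding poly_family_def
  by (intro conjI allI exI[of _ k]) (auto simp: degree_monom_le intro: polyfuns_if polyfuns.const)

lemma poly_family_add:
  assumes "poly_family I F" "poly_family I G"
  shows "poly_family I (\<lambda>u. F u + G u)"
proof -
  obtain D E where "\<And>u. degree (F u) \<le> D" "\<And>u. degree (G u) \<le> E"
    using assms unfolding poly_family_def by blast
  then have "degree (F u + G u) \<le> max D E" for u
    using degree_add_le_max[of "F u" "G u"] by (smt (verit) max.mono le_trans)
  then show ?thesis using assms unfolding poly_family_def by (auto intro: polyfuns.add)
qed

lemma poly_family_mult:
  assumes "poly_family I F" "poly_family I G"
  shows "poly_family I (\<lambda>u. F u * G u)"
proof -
  obtain D E where "\<And>u. degree (F u) \<le> D" "\<And>u. degree (G u) \<le> E"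
    using assms unfolding poly_family_def by blast
  then have "degree (F u * G u) \<le> D + E" for u
    using degree_mult_le[of "F u" "G u"] by (meson add_mono le_trans)
  then show ?thesis
    using assms unfolding poly_family_def
    by (auto simp: coeff_mult intro!: polyfuns_sum polyfuns.mult)
qed

lemma poly_family_diff:
  assumes "poly_family I F" "poly_family I G"
  shows "poly_family I (\<lambda>u. F u - G u)"
  using poly_family_add[OF assms(1) poly_family_mult[OF poly_family_const[of I "-1"] assms(2)]]
  by simp

lemma poly_family_sum:
  assumes "\<And>k. k \<in> K \<Longrightarrow> poly_family I (F k)"
  shows "poly_family I (\<lambda>u. \<Sum>k\<in>K. F k u)"
  using assms
  by (induction K rule: infinite_finite_induct) (auto intro: poly_family_const poly_family_add)

lemma poly_family_pderiv:
  assumes "poly_family I F"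
  shows "poly_family I (\<lambda>u. pderiv (F u))"
proof -
  obtain D where D: "\<And>u. degree (F u) \<le> D" using assms unfolding poly_family_def by blast
  have "degree (pderiv (F u)) \<le> D" for u
    using D[of u] by (simp add: degree_pderiv le_diff_conv trans_le_add1)
  then show ?thesis
    using assms unfolding poly_family_def
    by (auto simp: coeff_pderiv intro: polyfuns.mult polyfuns.const)
qed

lemma poly_family_compose:
  assumes "g \<in> polyfuns J" "\<And>j. j \<in> J \<Longrightarrow> poly_family I (c j)"
  shows "\<exists>R. poly_family I R \<and> (\<forall>u w. poly (R u) w = g (\<lambda>j. poly (c j u) w))"
  using assms(1)
proof induction
  case (const k)
  show ?case by (rule exI[of _ "\<lambda>u. [:k:]"]) (simp add: poly_family_const)
next
  case (coord j)
  then show ?case using assms(2) by blast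
next
  case (add f g)
  then obtain R S where "poly_family I R" "\<forall>u w. poly (R u) w = f (\<lambda>j. poly (c j u) w)"
    "poly_family I S" "\<forall>u w. poly (S u) w = g (\<lambda>j. poly (c j u) w)" by blast
  then show ?case by (intro exI[of _ "\<lambda>u. R u + S u"]) (simp add: poly_family_add)
next
  case (mult f g)
  then obtain R S where "poly_family I R" "\<forall>u w. poly (R u) w = f (\<lambda>j. poly (c j u) w)"
    "poly_family I S" "\<forall>u w. poly (S u) w = g (\<lambda>j. poly (c j u) w)" by blast
  then show ?case by (intro exI[of _ "\<lambda>u. R u * S u"]) (simp add: poly_family_mult)
qed

lemma poly_resultant_polyfuns:
  assumes "poly_family I F" "poly_family I G"
  shows "(\<lambda>u. poly_resultant D (F u) (G u)) \<in> polyfuns I"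
  unfolding poly_resultant_def
  using assms
  by (intro polyfuns_compose[OF hurwitz_Gamma_bar_polyfuns]) (auto simp: poly_family_def intro: polyfuns_if)

text \<open>Coprimality is an open condition as long as the degree of \<open>F\<close> does not drop.  The formal
  degrees are made equal by multiplying \<open>F\<close> with a power of a linear factor that does not divide
  \<open>G u0\<close>, so that the resultant of two polynomials of the same formal degree decides it.\<close>
lemma generic_no_common_root:
  assumes F: "poly_family I F" "\<And>u. degree (F u) \<le> d" and G: "poly_family I G"
    and u0: "coeff (F u0) d \<noteq> 0" "G u0 \<noteq> 0" "\<And>w. \<not> common_root (F u0) (G u0) w"
  obtains g where "g \<in> polyfuns I" "g u0 \<noteq> 0" "\<And>u w. g u \<noteq> 0 \<Longrightarrow> \<not> common_root (F u) (G u) w"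
proof -
  obtain E where E: "\<And>u. degree (G u) \<le> E" using G unfolding poly_family_def by blast
  define D where "D = max (max d E) 1"
  have D: "D \<ge> 1" "d \<le> D" "\<And>u. degree (G u) \<le> D"
    using E by (auto simp: D_def le_max_iff_disj)
  obtain \<tau> where \<tau>: "poly (G u0) \<tau> \<noteq> 0" using u0(2) poly_all_0_iff_0 by blast
  define L where "L = [:-\<tau>, 1:] ^ (D - d)"
  have "lead_coeff L = 1" unfolding L_def lead_coeff_power by simp
  then have L: "degree L = D - d" "lead_coeff L = 1" "L \<noteq> 0"
    by (auto simp: L_def degree_power_eq)
  have poly_L: "poly L w = 0 \<Longrightarrow> w = \<tau>" for w by (auto simp: L_def)
  have LF: "degree (L * F u) \<le> D" for u
    using degree_mult_le[of L "F u"] F(2)[of u] L(1) D(2) by linarith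
  have "degree (F u0) = d" using u0(1) F(2)[of u0] le_degree by (metis le_antisym)
  then have "coeff (L * F u0) D = coeff (F u0) d"
    using coeff_mult_degree_sum[of L "F u0"] L D(2) by simp
  moreover have "\<not> common_root (L * F u0) (G u0) w" for w
    using u0(3)[of w] \<tau> poly_L[of w] by auto
  ultimately have "poly_resultant D (L * F u0) (G u0) \<noteq> 0"
    using poly_resultant_eq_0_iff[OF D(1) LF D(3)] u0(1) by metis
  moreover have "\<not> common_root (F u) (G u) w" if "poly_resultant D (L * F u) (G u) \<noteq> 0" for u w
    using that poly_resultant_eq_0_iff[OF D(1) LF D(3)] by auto
  moreover have "(\<lambda>u. poly_resultant D (L * F u) (G u)) \<in> polyfuns I"
    by (intro poly_resultant_polyfuns poly_family_mult poly_family_const F G)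
  ultimately show thesis using that[of "\<lambda>u. poly_resultant D (L * F u) (G u)"] by blast
qed

text \<open>A double root of a member of the pencil is a root of the Wronskian, and no root of \<open>G\<close>;
  each such root determines the parameter.\<close>
lemma pencil_squarefree:
  fixes F G :: "complex poly"
  assumes cop: "\<And>w. \<not> common_root F G w" and F: "degree F > 0"
  shows "finite {t. \<exists>w. poly (F + Polynomial.smult t G) w = 0 \<and> poly (pderiv (F + Polynomial.smult t G)) w = 0}"
proof -
  define W where "W = F * pderiv G - pderiv F * G"
  have "W \<noteq> 0"
  proof
    assume "W = 0"
    then have "F dvd pderiv F * G" by (metis W_def dvd_triv_left eq_iff_diff_eq_0)
    moreover have "coprime F G" by (rule coprime_complex_poly) (use cop F in auto)
    ultimately have "F dvd pderiv F" using coprime_dvd_mult_left_iff by blast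
    moreover have "pderiv F \<noteq> 0" using F by (simp add: pderiv_eq_0_iff)
    ultimately show False using dvd_imp_degree_le[of F "pderiv F"] F by (simp add: degree_pderiv)
  qed
  then have "finite {w. poly W w = 0}" by (rule poly_roots_finite)
  moreover have "{t. \<exists>w. poly (F + Polynomial.smult t G) w = 0 \<and> poly (pderiv (F + Polynomial.smult t G)) w = 0}
      \<subseteq> (\<lambda>w. - poly F w / poly G w) ` {w. poly W w = 0}"
  proof clarify
    fix t w assume w: "poly (F + Polynomial.smult t G) w = 0" "poly (pderiv (F + Polynomial.smult t G)) w = 0"
    then have f: "poly F w = - t * poly G w" "poly (pderiv F) w = - t * poly (pderiv G) w"
      by (simp_all add: pderiv_add pderiv_smult eq_neg_iff_add_eq_0)
    then have "poly W w = 0" by (simp add: W_def)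
    moreover have "t = - poly F w / poly G w" using f cop[of w] by auto
    ultimately show "t \<in> (\<lambda>w. - poly F w / poly G w) ` {w. poly W w = 0}" by blast
  qed
  ultimately show ?thesis using finite_surj by blast
qed

lemma pencil_avoids:
  fixes F G :: "complex poly"
  assumes cop: "\<And>w. \<not> common_root F G w" and Z: "finite Z"
  shows "finite {t. \<exists>z\<in>Z. poly (F + Polynomial.smult t G) z = 0}"
proof (rule finite_subset)
  show "finite ((\<lambda>z. - poly F z / poly G z) ` Z)" using Z by simp
  show "{t. \<exists>z\<in>Z. poly (F + Polynomial.smult t G) z = 0} \<subseteq> (\<lambda>z. - poly F z / poly G z) ` Z"
  proof clarify
    fix t z assume z: "z \<in> Z" "poly (F + Polynomial.smult t G) z = 0"
    then have "poly F z = - t * poly G z" by (simp add: eq_neg_iff_add_eq_0)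
    then have "t = - poly F z / poly G z" using cop[of z] by auto
    then show "t \<in> (\<lambda>z. - poly F z / poly G z) ` Z" using z by blast
  qed
qed

lemma card_simple_roots:
  fixes p :: "complex poly"
  assumes "p \<noteq> 0" "\<And>w. \<not> common_root p (pderiv p) w"
  shows "card {w. poly p w = 0} = degree p"
proof -
  have "rsquarefree p" using assms(2) by (simp add: rsquarefree_roots)
  then have "p = Polynomial.smult (lead_coeff p) (\<Prod>z | poly p z = 0. [:- z, 1:])"
    by (simp add: complex_poly_decompose_rsquarefree)
  moreover have "degree (\<Prod>z | poly p z = 0. [:- z, 1:]) = card {z. poly p z = 0}"
    by (subst degree_prod_eq_sum_degree) auto
  ultimately show ?thesis using assms(1) by (metis degree_smult_eq leading_coeff_0_iff)
qed

section \<open>The gradient of the Hurwitz determinant\<close>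

lemma sylvester_row_combination:
  "sylvester_row n (\<lambda>i. c * x i + d * y i) i =
     Polynomial.smult c (sylvester_row n x i) + Polynomial.smult d (sylvester_row n y i)"
  by (simp add: sylvester_row_def even_part_combination odd_part_combination algebra_simps)

lemma poly_sylvester_row_common_root:
  "common_root (even_part n x) (odd_part n x) w \<Longrightarrow> poly (sylvester_row n x i) w = 0"
  by (simp add: sylvester_row_def)

definition kernel_column_mat :: "nat \<Rightarrow> (nat \<Rightarrow> complex) \<Rightarrow> (nat \<Rightarrow> complex) \<Rightarrow> complex \<Rightarrow> complex mat" where
  "kernel_column_mat n y v w = Matrix.mat (n - 1) (n - 1)
     (\<lambda>(i, j). if j = 0 then poly (sylvester_row n v i) w else coeff (sylvester_row n y i) j)"

text \<open>The column of powers of a common root \<open>w\<close> spans the kernel.  Adding the multiples of the other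
  columns to the first one turns that one into the value of the rows at \<open>w\<close>, which is linear in
  the perturbation; this splits off one factor \<open>t\<close>.\<close>
lemma hurwitz_Gamma_bar_perturbation:
  assumes n: "n \<ge> 2" and w: "common_root (even_part n x) (odd_part n x) w"
  shows "hurwitz_Gamma_bar n (\<lambda>i. x i + t * v i) =
     t * Determinant.det (kernel_column_mat n (\<lambda>i. x i + t * v i) v w)"
proof -
  define r where "r = n - 1"
  have r: "r > 0" using n by (simp add: r_def)
  let ?y = "\<lambda>i. x i + t * v i"
  let ?M = "hurwitz_minor n ?y" and ?K = "kernel_column_mat n ?y v w"
  \<comment> \<open>\<open>E\<close> adds the multiples of the columns, and \<open>T\<close> carries the factor \<open>t\<close> that splits off.\<close>
  define E where "E = Matrix.mat r r (\<lambda>(i, j). if j = 0 then w ^ i else if i = j then 1 else 0)"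
  define T where "T = Matrix.mat r r (\<lambda>(i, j). if i = j then (if i = 0 then t else 1) else 0)"
  have carrier: "?M \<in> carrier_mat r r" "?K \<in> carrier_mat r r" "E \<in> carrier_mat r r" "T \<in> carrier_mat r r"
    by (simp_all add: hurwitz_minor_def kernel_column_mat_def E_def T_def r_def)
  have detE: "Determinant.det E = 1"
  proof -
    have "Determinant.det E = prod_list (diag_mat E)"
      by (rule det_lower_triangular[OF _ carrier(3)]) (auto simp: E_def)
    also have "\<dots> = (\<Prod>i\<in>{0..<r}. E $$ (i, i))" using carrier(3) by (simp add: prod_list_diag_prod)
    also have "\<dots> = 1" by (rule prod.neutral) (auto simp: E_def)
    finally show ?thesis .
  qed
  have detT: "Determinant.det T = t"
  proof -
    have "Determinant.det T = prod_list (diag_mat T)"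
      by (rule det_lower_triangular[OF _ carrier(4)]) (auto simp: T_def)
    also have "\<dots> = (\<Prod>i\<in>{0..<r}. T $$ (i, i))" using carrier(4) by (simp add: prod_list_diag_prod)
    also have "\<dots> = (\<Prod>i\<in>{0..<r}. if i = 0 then t else 1)" by (rule prod.cong) (auto simp: T_def)
    also have "\<dots> = t" using r by simp
    finally show ?thesis .
  qed
  have "?M * E = ?K * T"
  proof (rule eq_matI)
    fix i j assume "i < dim_row (?K * T)" "j < dim_col (?K * T)"
    then have ij: "i < r" "j < r" using carrier by auto
    have "(?M * E) $$ (i, j) = (\<Sum>k<r. coeff (sylvester_row n ?y i) k * E $$ (k, j))"
      using ij carrier(1,3)
      by (auto simp: scalar_prod_def atLeast0LessThan hurwitz_minor_def r_def intro!: sum.cong)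
    also have "\<dots> = (if j = 0 then t * poly (sylvester_row n v i) w else coeff (sylvester_row n ?y i) j)"
    proof (cases "j = 0")
      case True
      have "(\<Sum>k<r. coeff (sylvester_row n ?y i) k * E $$ (k, j)) =
          (\<Sum>k<r. coeff (sylvester_row n ?y i) k * w ^ k)"
        using ij True by (intro sum.cong) (auto simp: E_def)
      also have "\<dots> = poly (sylvester_row n ?y i) w"
        using degree_sylvester_row[of i n] ij by (intro poly_eq_sum_lessThan[symmetric]) (simp add: r_def)
      also have "\<dots> = t * poly (sylvester_row n v i) w"
        using sylvester_row_combination[of n 1 x t v i] poly_sylvester_row_common_root[OF w, of i] by simp
      finally show ?thesis using True by simp
    next
      case False
      have "(\<Sum>k<r. coeff (sylvester_row n ?y i) k * E $$ (k, j)) =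
          (\<Sum>k<r. if k = j then coeff (sylvester_row n ?y i) k else 0)"
        using ij False by (intro sum.cong) (auto simp: E_def)
      then show ?thesis using ij False by simp
    qed
    also have "\<dots> = (\<Sum>k<r. if k = j then ?K $$ (i, k) * (if k = 0 then t else 1) else 0)"
      using ij by (simp add: kernel_column_mat_def r_def)
    also have "\<dots> = (\<Sum>k<r. ?K $$ (i, k) * T $$ (k, j))"
      using ij by (intro sum.cong) (auto simp: T_def)
    also have "\<dots> = (?K * T) $$ (i, j)"
      using ij carrier(2,4) by (auto simp: scalar_prod_def atLeast0LessThan intro!: sum.cong)
    finally show "(?M * E) $$ (i, j) = (?K * T) $$ (i, j)" .
  qed (use carrier in auto)
  then have "Determinant.det ?M * Determinant.det E = Determinant.det ?K * Determinant.det T"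
    using det_mult[OF carrier(1,3)] det_mult[OF carrier(2,4)] by simp
  then show ?thesis by (simp add: hurwitz_Gamma_bar_eq_det detE detT)
qed

lemma hurwitz_Gamma_bar_directional_derivative:
  assumes n: "n \<ge> 2" and w: "common_root (even_part n x) (odd_part n x) w"
  shows "((\<lambda>t. hurwitz_Gamma_bar n (\<lambda>i. x i + t * v i)) has_field_derivative
     Determinant.det (kernel_column_mat n x v w)) (at 0)"
proof -
  let ?K = "\<lambda>t. kernel_column_mat n (\<lambda>i. x i + t * v i) v w"
  have carrier: "?K t \<in> carrier_mat (n - 1) (n - 1)" for t by (simp add: kernel_column_mat_def)
  have entry: "isCont (\<lambda>t. ?K t $$ (i, j)) 0" if "i < n - 1" "j < n - 1" for i j
    using that sylvester_row_combination[of n 1 x _ v i]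
    by (cases "j = 0") (simp_all add: kernel_column_mat_def)
  have "isCont (\<lambda>t. Determinant.det (?K t)) 0"
    unfolding det_def'[OF carrier]
    by (intro continuous_intros entry) (use permutes_in_image in fastforce)+
  then show ?thesis
    unfolding CARAT_DERIV using hurwitz_Gamma_bar_perturbation[OF n w, of _ v] 
    by (intro exI[of _ "\<lambda>t. Determinant.det (?K t)"])
      (simp add: mult.commute hurwitz_Gamma_bar_perturbation[OF n w, of 0 v, simplified])
qed

text \<open>A left kernel vector of the matrix that represents the derivative annihilates the whole Sylvester
  matrix as well, so it is the syzygy \<open>(q1, - p1)\<close> of the two cofactors up to a constant; its
  pairing with the remaining column is the claimed relation.\<close>
lemma hurwitz_Gamma_bar_derivative_zero:
  assumes n: "n \<ge> 2" and p1: "even_part n x = [:-w, 1:] * p1" and q1: "odd_part n x = [:-w, 1:] * q1"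
    and cop: "\<And>z. \<not> common_root p1 q1 z" and top: "coeff p1 (n div 2 - 1) \<noteq> 0"
    and zero: "Determinant.det (kernel_column_mat n x v w) = 0"
  shows "poly q1 w * poly (even_part n v) w = poly p1 w * poly (odd_part n v) w"
proof -
  have w: "common_root (even_part n x) (odd_part n x) w" by (simp add: p1 q1)
  have "kernel_column_mat n x v w \<in> carrier_mat (n - 1) (n - 1)" by (simp add: kernel_column_mat_def)
  from det_zero_left_kernel[OF this zero] obtain h where h: "\<exists>i<n - 1. h i \<noteq> 0"
    "\<And>j. j < n - 1 \<Longrightarrow> (\<Sum>i<n - 1. h i * kernel_column_mat n x v w $$ (i, j)) = 0" by blast
  have pos: "(\<Sum>i<n - 1. h i * coeff (sylvester_row n x i) j) = 0" if "j < n - 1" "j \<noteq> 0" for j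
    using h(2)[OF that(1)] that by (simp add: kernel_column_mat_def)
  have "0 = (\<Sum>i<n - 1. h i * poly (sylvester_row n x i) w)"
    by (simp add: poly_sylvester_row_common_root[OF w])
  also have "\<dots> = (\<Sum>i<n - 1. h i * (\<Sum>j<n - 1. coeff (sylvester_row n x i) j * w ^ j))"
    using poly_eq_sum_lessThan[OF degree_sylvester_row] by (intro sum.cong) auto
  also have "\<dots> = (\<Sum>j<n - 1. (\<Sum>i<n - 1. h i * coeff (sylvester_row n x i) j) * w ^ j)"
    unfolding sum_distrib_left sum_distrib_right by (subst sum.swap) (simp add: mult.assoc)
  also have "\<dots> = (\<Sum>j<n - 1. if j = 0 then (\<Sum>i<n - 1. h i * coeff (sylvester_row n x i) 0) else 0)"
    using pos by (intro sum.cong) auto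
  also have "\<dots> = (\<Sum>i<n - 1. h i * coeff (sylvester_row n x i) 0)" using n by simp
  finally have ker: "(\<Sum>i<n - 1. h i * coeff (sylvester_row n x i) j) = 0" if "j < n - 1" for j
    using pos that by (cases "j = 0") auto
  obtain F G where FG: "F * even_part n x + G * odd_part n x = 0" "F \<noteq> 0 \<or> G \<noteq> 0"
    "F = 0 \<or> degree F < (n - 1) div 2" "G = 0 \<or> degree G < n div 2"
    "\<forall>v. (\<Sum>i<n - 1. Polynomial.smult (h i) (sylvester_row n v i)) = F * even_part n v + G * odd_part n v"
    by (rule left_kernel_syzygy[OF h(1) ker])
  have "(\<Sum>i<n - 1. h i * poly (sylvester_row n v i) w) = 0"
    using h(2)[of 0] n by (simp add: kernel_column_mat_def)
  then have pair: "poly F w * poly (even_part n v) w + poly G w * poly (odd_part n v) w = 0"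
    using arg_cong[OF FG(5)[rule_format, of v], of "\<lambda>p. poly p w"] by (simp add: poly_sum)
  have "[:-w, 1:] * (F * p1 + G * q1) = 0" using FG(1) by (simp add: p1 q1 algebra_simps)
  then have syz: "F * p1 + G * q1 = 0" by (simp only: mult_eq_0_iff) simp
  have p1_nz: "p1 \<noteq> 0" using top by auto
  have "coprime p1 q1" by (rule coprime_complex_poly) (use cop p1_nz in auto)
  moreover have "G * q1 = p1 * (- F)" using syz by (simp add: eq_neg_iff_add_eq_0 mult.commute add.commute)
  ultimately have "p1 dvd G" using coprime_dvd_mult_left_iff by (metis dvd_triv_left)
  then obtain H where H: "G = p1 * H" by (rule dvdE)
  have "p1 * (F + H * q1) = 0" using syz by (simp add: H algebra_simps)
  then have F: "F = - H * q1" using p1_nz by (simp add: eq_neg_iff_add_eq_0)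
  have H_nz: "H \<noteq> 0" using FG(2) by (auto simp: F H)
  have "degree H = 0"
    using FG(4) H_nz p1_nz le_degree[OF top] by (auto simp: H degree_mult_eq)
  then obtain c where c: "H = [:c:]" by (rule degree_eq_zeroE)
  then have "c = 0 \<or> poly p1 w * poly (odd_part n v) w = poly q1 w * poly (even_part n v) w"
    using pair by (simp add: F H algebra_simps)
  then show ?thesis using H_nz c by auto
qed

section \<open>Critical points and the incidence variety\<close>

definition unit_vec_at :: "nat \<Rightarrow> nat \<Rightarrow> complex" where
  "unit_vec_at j = (\<lambda>i. if i = j then 1 else 0)"

lemma unit_vec_at_same: "unit_vec_at j j = 1"
  by (simp add: unit_vec_at_def)

lemma unit_vec_at_other: "i \<noteq> j \<Longrightarrow> unit_vec_at j i = 0"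
  by (simp add: unit_vec_at_def)

lemma poly_even_part_unit:
  "poly (even_part n (unit_vec_at j)) w = (if even j \<and> j \<le> n then w ^ (j div 2) else 0)"
proof -
  have "poly (even_part n (unit_vec_at j)) w =
      (\<Sum>k\<le>n div 2. if k = j div 2 then (if even j then w ^ k else 0) else 0)"
    unfolding poly_even_part unit_vec_at_def by (rule sum.cong) auto
  then show ?thesis by (auto elim!: evenE)
qed

lemma poly_odd_part_unit:
  assumes "n \<ge> 1"
  shows "poly (odd_part n (unit_vec_at j)) w = (if odd j \<and> j \<le> n then w ^ (j div 2) else 0)"
proof -
  have "poly (odd_part n (unit_vec_at j)) w =
      (\<Sum>k\<le>(n - 1) div 2. if k = j div 2 then (if odd j then w ^ k else 0) else 0)"
    unfolding poly_odd_part unit_vec_at_def by (rule sum.cong) auto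
  then show ?thesis using assms by (auto elim!: oddE)
qed

lemma bilinear_form_combination:
  "bilinear_form I y (\<lambda>i. c * v i + d * v' i) = c * bilinear_form I y v + d * bilinear_form I y v'"
  by (simp add: bilinear_form_def sum.distrib sum_distrib_left algebra_simps)

lemma bilinear_form_unit:
  "finite I \<Longrightarrow> j \<in> I \<Longrightarrow> bilinear_form I y (unit_vec_at j) = y j"
  by (simp add: bilinear_form_def unit_vec_at_def if_distrib cong: if_cong)

lemma affine_space_unit: "j \<in> I \<Longrightarrow> unit_vec_at j \<in> affine_space I"
  by (auto simp: affine_space_def unit_vec_at_def)

lemma affine_space_combination:
  "v \<in> affine_space I \<Longrightarrow> v' \<in> affine_space I \<Longrightarrow> (\<lambda>i. c * v i + d * v' i) \<in> affine_space I"
  by (simp add: affine_space_def)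

text \<open>Both determinants are treated at once: \<open>\<delta> = 0\<close> is the homogeneous case and \<open>\<delta> = 1\<close> the case in
  which the coordinate \<open>x 0\<close> is frozen at \<open>1\<close>.\<close>
locale hurwitz_hypersurface =
  fixes n \<delta> :: nat
  assumes n: "n \<ge> 3" and \<delta>: "\<delta> \<le> 1"
begin

abbreviation "a \<equiv> n div 2"
abbreviation "b \<equiv> (n - 1) div 2"
abbreviation "I \<equiv> {\<delta>..n}"

definition hat :: "(nat \<Rightarrow> complex) \<Rightarrow> nat \<Rightarrow> complex" where
  "hat x = (\<lambda>i. if i < \<delta> then 1 else x i)"

abbreviation "P x \<equiv> even_part n (hat x)"
abbreviation "Q x \<equiv> odd_part n x"
abbreviation "\<Gamma> \<equiv> \<lambda>x. hurwitz_Gamma_bar n (hat x)"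
abbreviation "X \<equiv> hypersurface I \<Gamma>"

lemma ab: "a \<ge> 1" "b \<ge> 1" "b \<le> a" "a \<le> b + 1" "a + b = n - 1" "2 * a \<le> n" "2 * b + 1 \<le> n"
  using n by auto

lemma odd_part_hat: "odd_part n (hat x) = Q x"
  using \<delta> by (intro poly_eqI) (auto simp: coeff_odd_part hat_def)

lemma hat_perturbation:
  assumes "v \<in> affine_space I"
  shows "hat (\<lambda>i. x i + t * v i) = (\<lambda>i. hat x i + t * v i)"
  using assms by (auto simp: hat_def affine_space_def)

lemma Gamma_polyfuns: "\<Gamma> \<in> polyfuns I"
  unfolding hat_def using n
  by (intro polyfuns_compose[OF hurwitz_Gamma_bar_polyfuns] polyfuns_if polyfuns.const polyfuns.coord) auto

lemma Gamma_eq_0_iff: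
  "\<Gamma> x = 0 \<longleftrightarrow> (\<exists>w. common_root (P x) (Q x) w) \<or> (x (2 * a) = 0 \<and> x (2 * b + 1) = 0)"
proof -
  have "hat x (2 * a) = x (2 * a)" "hat x (2 * b + 1) = x (2 * b + 1)"
    using \<delta> ab by (auto simp: hat_def)
  then show ?thesis
    using hurwitz_Gamma_bar_eq_0_iff[of n "hat x"] n by (simp add: odd_part_hat)
qed

lemma root_nonzero: "\<delta> = 1 \<Longrightarrow> poly (P x) w = 0 \<Longrightarrow> w \<noteq> 0"
proof -
  assume "\<delta> = 1" "poly (P x) w = 0"
  moreover have "poly (P x) 0 = hat x 0" by (simp add: poly_0_coeff_0 coeff_even_part)
  moreover from \<open>\<delta> = 1\<close> have "hat x 0 = 1" unfolding hat_def by simp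
  ultimately show "w \<noteq> 0" by (metis one_neq_zero)
qed

lemma velocity_in_tangent_space:
  assumes v: "v \<in> affine_space I"
    and c: "\<And>i. i \<in> I \<Longrightarrow> ((\<lambda>s. c s i) has_field_derivative v i) (at 0)" "c 0 = x"
    and X: "\<forall>\<^sub>F s in nhds 0. c s \<in> X"
  shows "v \<in> tangent_space I X x"
proof -
  have "(\<Sum>i\<in>I. partial_deriv i f x * v i) = 0" if f: "f \<in> vanishing_ideal I X" for f
  proof -
    have "f \<in> polyfuns I" using f by (simp add: vanishing_ideal_def)
    then have "((\<lambda>s. f (c s)) has_field_derivative (\<Sum>i\<in>I. partial_deriv i f (c 0) * v i)) (at 0)"
      by (rule polyfuns_chain_rule) (use c(1) in auto)
    moreover have "\<forall>\<^sub>F s in nhds 0. f (c s) = 0"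
      using X by eventually_elim (use f in \<open>auto simp: vanishing_ideal_def\<close>)
    then have "((\<lambda>s. f (c s)) has_field_derivative 0) (at 0)"
      by (subst DERIV_cong_ev[OF refl _ refl]) auto
    ultimately show ?thesis using DERIV_unique c(2) by metis
  qed
  then show ?thesis using v by (simp add: tangent_space_def)
qed

text \<open>The hypersurface is swept out by the linear spaces of the points for which a given \<open>w\<close> is a common
  root.  The tangent vector \<open>v\<close> is realised by a curve along which the common root moves with speed
  \<open>e\<close>: the line through \<open>x\<close> is corrected, to second order, in the lowest free coefficient of each
  part.\<close>
lemma tangent_vector_finite:
  assumes x: "x \<in> affine_space I" and w: "common_root (P x) (Q x) w" and v: "v \<in> affine_space I"
    and vp: "poly (even_part n v) w + e * poly (pderiv (P x)) w = 0"
    and vq: "poly (odd_part n v) w + e * poly (pderiv (Q x)) w = 0"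
  shows "v \<in> tangent_space I X x"
proof -
  \<comment> \<open>The values at \<open>w + e * s\<close> of the two parts of the point \<open>x + s * v\<close>; they are to be corrected to \<open>0\<close>.\<close>
  define f where "f s = poly (P x) (w + e * s) + s * poly (even_part n v) (w + e * s)" for s
  define g where "g s = poly (Q x) (w + e * s) + s * poly (odd_part n v) (w + e * s)" for s
  define F where "F s = f s / (w + e * s) ^ \<delta>" for s
  have w_nz: "w ^ \<delta> \<noteq> 0" using root_nonzero[of x w] w \<delta> by (cases "\<delta> = 0") auto
  have "(f has_field_derivative (poly (pderiv (P x)) w * e + poly (even_part n v) w)) (at 0)"
    unfolding f_def by (auto intro!: derivative_eq_intros DERIV_chain2[OF poly_DERIV])
  then have f': "(f has_field_derivative 0) (at 0)" using vp by (simp add: algebra_simps)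
  have "(g has_field_derivative (poly (pderiv (Q x)) w * e + poly (odd_part n v) w)) (at 0)"
    unfolding g_def by (auto intro!: derivative_eq_intros DERIV_chain2[OF poly_DERIV])
  then have g': "(g has_field_derivative 0) (at 0)" using vq by (simp add: algebra_simps)
  have f0: "f 0 = 0" "g 0 = 0" using w by (auto simp: f_def g_def)
  have "((\<lambda>s. (w + e * s) ^ \<delta>) has_field_derivative (of_nat \<delta> * e * w ^ (\<delta> - 1))) (at 0)"
    by (auto intro!: derivative_eq_intros)
  from DERIV_divide[OF f' this] have F': "(F has_field_derivative 0) (at 0)"
    unfolding F_def using w_nz f0 by simp
  define c where "c s = (\<lambda>i. (x i + s * v i) +
      (-1) * (F s * unit_vec_at (2 * \<delta>) i + g s * unit_vec_at 1 i))" for s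
  have idx: "2 * \<delta> \<in> I" "1 \<in> I" using n \<delta> by auto
  show ?thesis
  proof (rule velocity_in_tangent_space[OF v])
    show "((\<lambda>s. c s i) has_field_derivative v i) (at 0)" for i
      unfolding c_def by (auto intro!: derivative_eq_intros F' g')
    show "c 0 = x" using f0 by (simp add: c_def F_def)
    have "((\<lambda>s. (w + e * s) ^ \<delta>) \<longlongrightarrow> (w + e * 0) ^ \<delta>) (nhds 0)"
      by (intro tendsto_intros filterlim_ident)
    then have "\<forall>\<^sub>F s in nhds 0. (w + e * s) ^ \<delta> \<noteq> 0"
      using w_nz by (intro tendsto_imp_eventually_ne) auto
    then show "\<forall>\<^sub>F s in nhds 0. c s \<in> X"
    proof eventually_elim
      case (elim s)
      have corr: "(\<lambda>i. F s * unit_vec_at (2 * \<delta>) i + g s * unit_vec_at 1 i) \<in> affine_space I"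
        by (intro affine_space_combination affine_space_unit idx)
      have line: "(\<lambda>i. x i + s * v i) \<in> affine_space I"
        using affine_space_combination[OF x v, of 1 s] by simp
      have aff: "c s \<in> affine_space I"
        using affine_space_combination[OF line corr, of 1 "-1"] by (simp add: c_def)
      have P: "poly (P (c s)) z = poly (P x) z + s * poly (even_part n v) z - F s * z ^ \<delta>" for z
        unfolding c_def hat_perturbation[OF corr] hat_perturbation[OF v]
        using even_part_combination[of n 1 "\<lambda>i. hat x i + s * v i" "-1"
            "\<lambda>i. F s * unit_vec_at (2 * \<delta>) i + g s * unit_vec_at 1 i"]
          even_part_combination[of n 1 "hat x" s v] n \<delta>
        by (simp add: even_part_combination poly_even_part_unit)
      have Q: "poly (Q (c s)) z = poly (Q x) z + s * poly (odd_part n v) z - g s" for z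
        unfolding c_def
        using odd_part_combination[of n 1 "\<lambda>i. x i + s * v i" "-1"
            "\<lambda>i. F s * unit_vec_at (2 * \<delta>) i + g s * unit_vec_at 1 i"]
          odd_part_combination[of n 1 x s v] n
        by (simp add: odd_part_combination poly_odd_part_unit)
      have "common_root (P (c s)) (Q (c s)) (w + e * s)"
        using elim by (simp add: P Q F_def f_def g_def)
      then show "c s \<in> X" using aff Gamma_eq_0_iff by (auto simp: hypersurface_def)
    qed
  qed
qed

lemma sum_last:
  fixes m :: nat and f :: "nat \<Rightarrow> complex"
  assumes "m \<ge> 1"
  shows "(\<Sum>k<m. if m - k = 1 then f k else 0) = f (m - 1)"
proof -
  have "(\<Sum>k<m. if m - k = 1 then f k else 0) = (\<Sum>k<m. if k = m - 1 then f k else 0)"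
    by (intro sum.cong if_cong refl) auto
  then show ?thesis using assms by simp
qed

lemma derivative_vanishing_product:
  assumes "m \<ge> 1"
  shows "((\<lambda>s. (c + s * d) * (e * s) ^ m) has_field_derivative (if m = 1 then c * e else 0)) (at (0 :: complex))"
proof -
  have "((\<lambda>s. (c + s * d) * (e * s) ^ m) has_field_derivative
      (c + 0 * d) * (of_nat m * (e * 0) ^ (m - 1) * e) + d * (e * 0) ^ m) (at 0)"
    by (rule derivative_eq_intros refl | simp)+
  then show ?thesis using assms by (cases "m = 1") (auto simp: power_0_left)
qed

text \<open>Near a common root at infinity the root is \<open>1 / (e * s)\<close>; it remains a root if the two top
  coefficients absorb the values of the other ones.\<close>
lemma tangent_vector_infinity:
  assumes x: "x \<in> affine_space I" "x (2 * a) = 0" "x (2 * b + 1) = 0" and v: "v \<in> affine_space I"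
    and vp: "v (2 * a) + e * hat x (2 * a - 2) = 0"
    and vq: "v (2 * b + 1) + e * x (2 * b - 1) = 0"
  shows "v \<in> tangent_space I X x"
proof -
  define f where "f s = (\<Sum>k<a. (hat x (2 * k) + s * v (2 * k)) * (e * s) ^ (a - k))" for s
  define g where "g s = (\<Sum>k<b. (x (2 * k + 1) + s * v (2 * k + 1)) * (e * s) ^ (b - k))" for s
  define c where "c s = (\<lambda>i. if i = 2 * a then - f s else if i = 2 * b + 1 then - g s else x i + s * v i)" for s
  have top: "2 * a \<in> I" "2 * b + 1 \<in> I" "2 * a \<noteq> 2 * b + 1" using n \<delta> by (auto, presburger)
  have "(f has_field_derivative (\<Sum>k<a. if a - k = 1 then hat x (2 * k) * e else 0)) (at 0)"
    unfolding f_def by (intro DERIV_sum derivative_vanishing_product) auto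
  moreover have "(\<Sum>k<a. if a - k = 1 then hat x (2 * k) * e else 0) = hat x (2 * (a - 1)) * e"
    by (rule sum_last[OF ab(1)])
  moreover have "2 * (a - 1) = 2 * a - 2" by simp
  moreover have "hat x (2 * a - 2) * e = - v (2 * a)"
    using vp by (simp add: eq_neg_iff_add_eq_0 algebra_simps)
  ultimately have f': "(f has_field_derivative - v (2 * a)) (at 0)" by (simp only:)
  have "(g has_field_derivative (\<Sum>k<b. if b - k = 1 then x (2 * k + 1) * e else 0)) (at 0)"
    unfolding g_def by (intro DERIV_sum derivative_vanishing_product) auto
  moreover have "(\<Sum>k<b. if b - k = 1 then x (2 * k + 1) * e else 0) = x (2 * (b - 1) + 1) * e"
    by (rule sum_last[OF ab(2)])
  moreover have "2 * (k - 1) + 1 = 2 * k - 1" if "k \<ge> 1" for k :: nat using that by simp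
  note this[OF ab(2)]
  moreover have "x (2 * b - 1) * e = - v (2 * b + 1)"
    using vq by (simp add: eq_neg_iff_add_eq_0 algebra_simps)
  ultimately have g': "(g has_field_derivative - v (2 * b + 1)) (at 0)" by (simp only:)
  have f0: "f 0 = 0" "g 0 = 0" by (auto simp: f_def g_def intro!: sum.neutral)
  have c_even: "c s (2 * a) = - f s" for s by (simp only: c_def if_True refl)
  have c_odd: "c s (2 * b + 1) = - g s" for s
    using top(3)[symmetric] by (simp only: c_def if_False if_True refl)
  have c_other: "c s i = x i + s * v i" if "i \<noteq> 2 * a" "i \<noteq> 2 * b + 1" for i s
    using that by (simp only: c_def if_False)
  show ?thesis
  proof (rule velocity_in_tangent_space[OF v])
    show "((\<lambda>s. c s i) has_field_derivative v i) (at 0)" for i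
    proof -
      consider "i = 2 * a" | "i = 2 * b + 1" | "i \<noteq> 2 * a" "i \<noteq> 2 * b + 1" by blast
      then show ?thesis
      proof cases
        case 1
        then have "(\<lambda>s. c s i) = (\<lambda>s. - f s)" using c_even by blast
        then show ?thesis using 1 DERIV_minus[OF f'] by (simp only: minus_minus)
      next
        case 2
        then have "(\<lambda>s. c s i) = (\<lambda>s. - g s)" using c_odd by blast
        then show ?thesis using 2 DERIV_minus[OF g'] by (simp only: minus_minus)
      next
        case 3
        then have "(\<lambda>s. c s i) = (\<lambda>s. x i + s * v i)" using c_other by blast
        then show ?thesis by (auto intro!: derivative_eq_intros)
      qed
    qed
    show "c 0 = x"
    proof
      fix i
      show "c 0 i = x i"
        using f0 x(2,3) c_even[of 0] c_odd[of 0] c_other[of i 0]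
        by (metis mult_zero_left add_0_right minus_zero)
    qed
    have "c s \<in> X" for s
    proof -
      have aff: "c s \<in> affine_space I"
        unfolding affine_space_def
      proof (intro CollectI allI impI)
        fix i assume i: "i \<notin> I"
        then have "i \<noteq> 2 * a" "i \<noteq> 2 * b + 1" using top by metis+
        then show "c s i = 0" using c_other[of i s] i x(1) v by (simp add: affine_space_def)
      qed
      show "c s \<in> X"
      proof (cases "e * s = 0")
        case True
        then have "f s = 0" "g s = 0" by (auto simp: f_def g_def intro!: sum.neutral)
        then have "c s (2 * a) = 0" "c s (2 * b + 1) = 0" using c_even c_odd by (metis neg_0_equal_iff_equal)+
        then show ?thesis using aff Gamma_eq_0_iff by (auto simp: hypersurface_def)
      next
        case False
        define w where "w = 1 / (e * s)"
        have pow: "(e * s) ^ (m - k) * w ^ m = w ^ k" if "k \<le> m" for k m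
        proof -
          have "w ^ m = w ^ (m - k) * w ^ k" using that by (simp flip: power_add)
          moreover have "(e * s) ^ (m - k) * w ^ (m - k) = 1"
            using False by (simp add: w_def flip: power_mult_distrib)
          ultimately show ?thesis by (metis mult.assoc mult_1)
        qed
        have "poly (P (c s)) w = (\<Sum>k<a. hat (c s) (2 * k) * w ^ k) + hat (c s) (2 * a) * w ^ a"
          unfolding poly_even_part lessThan_Suc_atMost[symmetric] sum.lessThan_Suc ..
        also have "(\<Sum>k<a. hat (c s) (2 * k) * w ^ k) = (\<Sum>k<a. (hat x (2 * k) + s * v (2 * k)) * w ^ k)"
        proof (intro sum.cong refl arg_cong2[of _ _ _ _ "(*)"])
          fix k assume "k \<in> {..<a}"
          then have ne: "2 * k \<noteq> 2 * a" by simp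
          have "2 * k \<noteq> 2 * l + 1" for l by presburger
          from c_other[OF ne this[of b], of s]
          have "hat (c s) (2 * k) = hat (\<lambda>i. x i + s * v i) (2 * k)" by (simp only: hat_def)
          then show "hat (c s) (2 * k) = hat x (2 * k) + s * v (2 * k)"
            by (simp only: hat_perturbation[OF v])
        qed
        also have "hat (c s) (2 * a) = - f s" using top(1) c_even[of s] by (simp add: hat_def)
        also have "(\<Sum>k<a. (hat x (2 * k) + s * v (2 * k)) * w ^ k) + - f s * w ^ a = 0"
          unfolding f_def using pow[of _ a]
          by (simp add: sum_distrib_right mult.assoc)
        finally have P: "poly (P (c s)) w = 0" .
        have "poly (Q (c s)) w = (\<Sum>k<b. c s (2 * k + 1) * w ^ k) + c s (2 * b + 1) * w ^ b"
          unfolding poly_odd_part lessThan_Suc_atMost[symmetric] sum.lessThan_Suc ..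
        also have "(\<Sum>k<b. c s (2 * k + 1) * w ^ k) = (\<Sum>k<b. (x (2 * k + 1) + s * v (2 * k + 1)) * w ^ k)"
        proof (intro sum.cong refl arg_cong2[of _ _ _ _ "(*)"])
          fix k assume "k \<in> {..<b}"
          then have ne: "2 * k + 1 \<noteq> 2 * b + 1" by simp
          have "2 * k + 1 \<noteq> 2 * l" for l by presburger
          from c_other[OF this[of a] ne]
          show "c s (2 * k + 1) = x (2 * k + 1) + s * v (2 * k + 1)" .
        qed
        also have "c s (2 * b + 1) = - g s" by (rule c_odd)
        also have "(\<Sum>k<b. (x (2 * k + 1) + s * v (2 * k + 1)) * w ^ k) + - g s * w ^ b = 0"
          unfolding g_def using pow[of _ b]
          by (simp add: sum_distrib_right mult.assoc)
        finally have "poly (Q (c s)) w = 0" .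
        then show ?thesis using P aff Gamma_eq_0_iff by (auto simp: hypersurface_def)
      qed
    qed
    then show "\<forall>\<^sub>F s in nhds 0. c s \<in> X" by simp
  qed
qed

text \<open>These two vectors span the orthogonal complement of the linear space of directions in which \<open>w\<close>
  remains a common root.\<close>
definition even_powers :: "complex \<Rightarrow> nat \<Rightarrow> complex" where
  "even_powers w i = (if even i \<and> i \<in> I then w ^ (i div 2) else 0)"

definition odd_powers :: "complex \<Rightarrow> nat \<Rightarrow> complex" where
  "odd_powers w i = (if odd i \<and> i \<in> I then w ^ (i div 2) else 0)"

text \<open>The normal vector \<open>u - x\<close> is orthogonal to the tangent vectors that change only two coordinates and
  leave the common root in place, which determines it up to the two factors \<open>\<alpha>\<close> and \<open>\<beta>\<close>.  A tangent
  vector that moves the root gives the relation between them.\<close>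
lemma critical_point_finite:
  assumes u: "u \<in> affine_space I" and x: "x \<in> critical_points I X u"
    and w: "common_root (P x) (Q x) w"
  obtains \<alpha> \<beta> where "u = (\<lambda>i. x i + (\<alpha> * even_powers w i + \<beta> * odd_powers w i))"
    "\<alpha> * poly (pderiv (P x)) w + \<beta> * poly (pderiv (Q x)) w = 0"
proof -
  have x_aff: "x \<in> affine_space I" using x by (simp add: critical_points_def hypersurface_def)
  define y where "y = (\<lambda>i. u i - x i)"
  have y_aff: "y \<in> affine_space I" using u x_aff by (simp add: y_def affine_space_def)
  have orth: "bilinear_form I y v = 0" if "v \<in> tangent_space I X x" for v
    using x that by (simp add: critical_points_def y_def)
  have w_nz: "w ^ \<delta> \<noteq> 0" using root_nonzero[of x w] w \<delta> by (cases "\<delta> = 0") auto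
  have idx: "2 * \<delta> \<in> I" "1 \<in> I" "2 * \<delta> \<le> n" using n \<delta> by auto
  define \<alpha> where "\<alpha> = y (2 * \<delta>) / w ^ \<delta>"
  define \<beta> where "\<beta> = y 1"
  \<comment> \<open>Orthogonality to the tangent vector with entries \<open>c\<close> at \<open>i\<close> and \<open>d\<close> at \<open>j\<close>, along which the root has speed \<open>e\<close>.\<close>
  have test: "c * y i + d * y j = 0"
    if "i \<in> I" "j \<in> I"
      "c * poly (even_part n (unit_vec_at i)) w + d * poly (even_part n (unit_vec_at j)) w
         + e * poly (pderiv (P x)) w = 0"
      "c * poly (odd_part n (unit_vec_at i)) w + d * poly (odd_part n (unit_vec_at j)) w
         + e * poly (pderiv (Q x)) w = 0" for i j c d e
  proof -
    have "(\<lambda>k. c * unit_vec_at i k + d * unit_vec_at j k) \<in> tangent_space I X x"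
      using that
      by (intro tangent_vector_finite[OF x_aff w, of _ e] affine_space_combination affine_space_unit)
        (simp_all add: even_part_combination odd_part_combination)
    from orth[OF this] show ?thesis
      using that(1,2) by (simp add: bilinear_form_combination bilinear_form_unit)
  qed
  have "y i = \<alpha> * even_powers w i + \<beta> * odd_powers w i" for i
  proof (cases "i \<in> I")
    case True
    show ?thesis
    proof (cases "even i")
      case ev: True
      then have k: "i div 2 \<ge> \<delta>" using True \<delta> by (cases "\<delta> = 0") (auto elim!: evenE)
      then have split: "w ^ (i div 2) = w ^ (i div 2 - \<delta>) * w ^ \<delta>" by (simp flip: power_add)
      have "1 * y i + (- (w ^ (i div 2 - \<delta>))) * y (2 * \<delta>) = 0"
        using True ev idx n by (intro test[of _ _ _ _ 0]) (auto simp: poly_even_part_unit poly_odd_part_unit split)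
      then have y: "y i = w ^ (i div 2 - \<delta>) * y (2 * \<delta>)" by (simp add: add_eq_0_iff2)
      have "c / W * (V * W) = V * c" if "W \<noteq> 0" for c V W :: complex using that by simp
      from this[OF w_nz] have "\<alpha> * w ^ (i div 2) = w ^ (i div 2 - \<delta>) * y (2 * \<delta>)"
        unfolding \<alpha>_def split .
      then show ?thesis using ev True y by (simp add: even_powers_def odd_powers_def)
    next
      case od: False
      have "1 * y i + (- (w ^ (i div 2))) * y 1 = 0"
        using True od idx n by (intro test[of _ _ _ _ 0]) (auto simp: poly_even_part_unit poly_odd_part_unit)
      then show ?thesis
        using od True by (simp add: even_powers_def odd_powers_def \<beta>_def)
    qed
  next
    case False
    then show ?thesis using y_aff by (auto simp: even_powers_def odd_powers_def affine_space_def)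
  qed
  then have "u = (\<lambda>i. x i + (\<alpha> * even_powers w i + \<beta> * odd_powers w i))"
    by (simp add: y_def fun_eq_iff algebra_simps)
  moreover have "(poly (pderiv (P x)) w / w ^ \<delta>) * y (2 * \<delta>) + poly (pderiv (Q x)) w * y 1 = 0"
    using idx n w_nz by (intro test[of _ _ _ _ "-1"]) (simp_all add: poly_even_part_unit poly_odd_part_unit)
  then have "\<alpha> * poly (pderiv (P x)) w + \<beta> * poly (pderiv (Q x)) w = 0"
    by (simp add: \<alpha>_def \<beta>_def mult.commute)
  ultimately show thesis by (rule that)
qed

text \<open>The relation between the two factors at a common root at infinity; there the factors and the
  derivatives of the two parts are coordinates of \<open>u\<close>.\<close>
lemma critical_point_infinity:
  assumes u: "u \<in> affine_space I" and x: "x \<in> critical_points I X u"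
    and top: "x (2 * a) = 0" "x (2 * b + 1) = 0"
  shows "u (2 * a) * hat u (2 * a - 2) + u (2 * b + 1) * u (2 * b - 1) = 0"
proof -
  have x_aff: "x \<in> affine_space I" using x by (simp add: critical_points_def hypersurface_def)
  have orth: "bilinear_form I (\<lambda>i. u i - x i) v = 0" if "v \<in> tangent_space I X x" for v
    using x that by (simp add: critical_points_def)
  have idx: "2 * a \<in> I" "2 * b + 1 \<in> I" "2 * b - 1 \<in> I"
    unfolding atLeastAtMost_iff using ab(1,2,6,7) \<delta> by linarith+
  have "2 * k \<noteq> 2 * l + 1 \<and> 2 * k \<noteq> 2 * l - 1 \<and> 2 * k - 2 \<noteq> 2 * l + 1 \<and> 2 * l - 1 \<noteq> 2 * l + 1 \<and>
      2 * k - 2 \<noteq> 2 * k" if "k \<ge> 1" "l \<ge> 1" for k l :: nat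
    using that by presburger
  from this[OF ab(1,2)] have neq: "2 * a \<noteq> 2 * b + 1" "2 * a \<noteq> 2 * b - 1" "2 * a - 2 \<noteq> 2 * b + 1"
    "2 * b - 1 \<noteq> 2 * b + 1" "2 * a - 2 \<noteq> 2 * a"
    by auto
  note unit = unit_vec_at_same unit_vec_at_other[OF neq(1)] unit_vec_at_other[OF neq(1)[symmetric]]
    unit_vec_at_other[OF neq(2)] unit_vec_at_other[OF neq(3)[symmetric]]
    unit_vec_at_other[OF neq(4)[symmetric]] unit_vec_at_other[OF neq(5)[symmetric]]
  have "hat u (2 * a - 2) = hat x (2 * a - 2)"
  proof (cases "2 * a - 2 \<in> I")
    case True
    then have "unit_vec_at (2 * a - 2) \<in> tangent_space I X x"
      by (intro tangent_vector_infinity[OF x_aff top, of _ 0] affine_space_unit)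
        (simp_all only: unit mult_zero_left add_0_right)
    from orth[OF this] have "u (2 * a - 2) = x (2 * a - 2)"
      by (simp only: bilinear_form_unit[OF _ True] finite_atLeastAtMost right_minus_eq)
    then show ?thesis by (simp only: hat_def)
  next
    case False
    moreover have "2 * a - 2 \<le> n" using ab(6) by linarith
    ultimately have "2 * a - 2 < \<delta>" by (meson atLeastAtMost_iff not_le)
    then show ?thesis by (simp only: hat_def if_True)
  qed
  moreover have "u (2 * b - 1) = x (2 * b - 1)"
  proof -
    have "unit_vec_at (2 * b - 1) \<in> tangent_space I X x"
      by (intro tangent_vector_infinity[OF x_aff top, of _ 0] affine_space_unit idx)
        (simp_all only: unit mult_zero_left add_0_right)
    from orth[OF this] show ?thesis
      by (simp only: bilinear_form_unit[OF _ idx(3)] finite_atLeastAtMost right_minus_eq)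
  qed
  moreover have "hat x (2 * a - 2) * u (2 * a) + x (2 * b - 1) * u (2 * b + 1) = 0"
  proof -
    have "(\<lambda>i. hat x (2 * a - 2) * unit_vec_at (2 * a) i + x (2 * b - 1) * unit_vec_at (2 * b + 1) i)
        \<in> tangent_space I X x"
      by (intro tangent_vector_infinity[OF x_aff top, of _ "-1"] affine_space_combination affine_space_unit idx)
        (simp_all only: unit, simp_all)
    from orth[OF this] show ?thesis
      by (simp only: bilinear_form_combination bilinear_form_unit[OF _ idx(1)] bilinear_form_unit[OF _ idx(2)]
          finite_atLeastAtMost top diff_zero)
  qed
  ultimately show ?thesis by (simp add: mult.commute)
qed

end

section \<open>Quotients of polynomials and geometric sums\<close>

lemma coeff_mult_at_bounds:
  fixes F G :: "complex poly"
  assumes "degree F \<le> m" "degree G \<le> k"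
  shows "coeff (F * G) (m + k) = coeff F m * coeff G k"
proof -
  have "coeff (F * G) (m + k) = (\<Sum>i\<le>m + k. if i = m then coeff F m * coeff G k else 0)"
    unfolding coeff_mult
  proof (rule sum.cong)
    fix i assume "i \<in> {..m + k}"
    show "coeff F i * coeff G (m + k - i) = (if i = m then coeff F m * coeff G k else 0)"
    proof (cases i m rule: linorder_cases)
      case less
      then have "coeff G (m + k - i) = 0" using assms(2) by (intro coeff_eq_0) linarith
      then show ?thesis using less by simp
    next
      case greater
      then have "coeff F i = 0" using assms(1) by (intro coeff_eq_0) linarith
      then show ?thesis using greater by simp
    qed simp
  qed simp
  then show ?thesis by simp
qed

lemma pderiv_sum_poly: "pderiv (\<Sum>k\<in>K. f k :: complex poly) = (\<Sum>k\<in>K. pderiv (f k))"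
  by (induction K rule: infinite_finite_induct) (auto simp: pderiv_add)

lemma coeff_synthetic_div:
  fixes p :: "complex poly"
  assumes "degree p \<le> m"
  shows "coeff (synthetic_div p c) j = (\<Sum>k\<in>{j<..m}. coeff p k * c ^ (k - 1 - j))"
  using assms
proof (induction p arbitrary: m j)
  case 0
  then show ?case by simp
next
  case (pCons r p)
  show ?case
  proof (cases "p = 0")
    case True
    have "coeff (pCons r 0) k = 0" if "k \<in> {j<..m}" for k
      using that by (cases k) auto
    then show ?thesis using True by simp
  next
    case False
    then obtain l where l: "m = Suc l" "degree p \<le> l"
      using pCons.prems by (cases m) auto
    show ?thesis
    proof (cases j)
      case 0
      have "poly p c = (\<Sum>k\<le>l. coeff p k * c ^ k)"
        using l(2) poly_eq_sum_lessThan[of p "Suc l" c] by (simp add: lessThan_Suc_atMost)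
      also have "\<dots> = (\<Sum>k\<in>{0<..Suc l}. coeff (pCons r p) k * c ^ (k - 1 - 0))"
        by (rule sum.reindex_bij_witness[of _ "\<lambda>k. k - 1" Suc]) auto
      finally show ?thesis using 0 l by simp
    next
      case (Suc i)
      have "(\<Sum>k\<in>{i<..l}. coeff p k * c ^ (k - 1 - i)) =
          (\<Sum>k\<in>{Suc i<..Suc l}. coeff (pCons r p) k * c ^ (k - 1 - Suc i))"
        by (rule sum.reindex_bij_witness[of _ "\<lambda>k. k - 1" Suc]) (auto simp: coeff_pCons split: nat.splits)
      then show ?thesis using pCons.IH[OF l(2), of i] Suc l by simp
    qed
  qed
qed

lemma synthetic_div_root:
  fixes p :: "complex poly"
  shows "poly p c = 0 \<Longrightarrow> [:-c, 1:] * synthetic_div p c = p"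
  using synthetic_div_correct'[of c p] by simp

text \<open>The derivative of \<open>F\<^sup>2 / G\<close> is \<open>F * quotient_numerator F G / G\<^sup>2\<close>.\<close>
definition quotient_numerator :: "complex poly \<Rightarrow> complex poly \<Rightarrow> complex poly" where
  "quotient_numerator F G = Polynomial.smult 2 (pderiv F * G) - F * pderiv G"

text \<open>The top coefficients cancel, because \<open>F\<^sup>2 / G\<close> has formal degree \<open>0\<close>.\<close>
lemma degree_quotient_numerator:
  assumes F: "degree F \<le> c" and G: "degree G \<le> 2 * c" and c: "c \<ge> 1"
  shows "degree (quotient_numerator F G) \<le> 3 * c - 2"
proof -
  have "degree (pderiv F) \<le> c - 1" "degree (pderiv G) \<le> 2 * c - 1"
    using F G by (auto simp: degree_pderiv)
  note deg = coeff_mult_at_bounds[OF this(1) G] coeff_mult_at_bounds[OF F this(2)]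
    degree_mult_le[of "pderiv F" G] degree_mult_le[of F "pderiv G"] this
  have idx: "c - 1 + 2 * c = 3 * c - 1" "c + (2 * c - 1) = 3 * c - 1" using c by auto
  have "coeff (quotient_numerator F G) (3 * c - 1) = 0"
    using deg(1,2) c unfolding idx quotient_numerator_def
    by (simp add: coeff_pderiv of_nat_diff)
  moreover have "degree (quotient_numerator F G) \<le> 3 * c - 1"
    unfolding quotient_numerator_def using deg(3-6) F G idx
    by (intro degree_diff_le) (auto intro: order_trans[OF degree_smult_le])
  ultimately have *: "coeff (quotient_numerator F G) (3 * c - 1) = 0"
    "degree (quotient_numerator F G) \<le> 3 * c - 1" by simp_all
  show ?thesis
  proof (rule ccontr)
    assume n: "\<not> degree (quotient_numerator F G) \<le> 3 * c - 2"
    then have "degree (quotient_numerator F G) = 3 * c - 1" using *(2) by linarith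
    then have "quotient_numerator F G = 0" using *(1) leading_coeff_0_iff by metis
    then show False using n by simp
  qed
qed

definition even_geometric :: "nat \<Rightarrow> complex poly" where
  "even_geometric m = (\<Sum>k\<le>m. monom 1 (2 * k))"

lemma poly_even_geometric: "poly (even_geometric m) w = (\<Sum>k\<le>m. w ^ (2 * k))"
  by (simp add: even_geometric_def poly_sum poly_monom)

lemma coeff_even_geometric: "coeff (even_geometric m) k = (if even k \<and> k \<le> 2 * m then 1 else 0)"
proof -
  have "coeff (even_geometric m) k = (\<Sum>l\<le>m. if l = k div 2 then (if even k then 1 else 0) else 0)"
    unfolding even_geometric_def coeff_sum by (rule sum.cong) auto
  then show ?thesis by (auto elim!: evenE)
qed

lemma degree_even_geometric: "degree (even_geometric m) = 2 * m"
proof (rule antisym)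
  show "degree (even_geometric m) \<le> 2 * m" by (rule degree_le) (simp add: coeff_even_geometric)
  show "2 * m \<le> degree (even_geometric m)" by (rule le_degree) (simp add: coeff_even_geometric)
qed

lemma even_geometric_nonzero: "even_geometric m \<noteq> 0"
  using coeff_even_geometric[of m 0] by auto

lemma poly_even_geometric_special: "poly (even_geometric m) 0 \<noteq> 0" "poly (even_geometric m) (-1) \<noteq> 0"
proof -
  show "poly (even_geometric m) 0 \<noteq> 0" by (simp add: poly_0_coeff_0 coeff_even_geometric)
  have "poly (even_geometric m) (-1) = of_nat (m + 1)" by (simp add: poly_even_geometric)
  then show "poly (even_geometric m) (-1) \<noteq> 0" by (metis of_nat_eq_0_iff add_is_0 one_neq_zero)
qed

text \<open>The roots are roots of unity: \<open>(t\<^sup>2 - 1) * even_geometric m = t ^ (2 m + 2) - 1\<close>.\<close>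
lemma even_geometric_squarefree: "\<not> common_root (even_geometric m) (pderiv (even_geometric m)) z"
proof
  assume z: "common_root (even_geometric m) (pderiv (even_geometric m)) z"
  have eq: "(monom 1 2 - 1) * even_geometric m = monom 1 (2 * m + 2) - 1"
  proof (induction m)
    case (Suc m)
    have "even_geometric (Suc m) = even_geometric m + monom 1 (2 * m + 2)"
      by (simp add: even_geometric_def)
    then have "(monom 1 2 - 1) * even_geometric (Suc m) =
        (monom 1 2 - 1) * even_geometric m + (monom 1 2 - 1) * monom 1 (2 * m + 2)"
      by (simp only: distrib_left)
    then show ?case unfolding Suc by (simp add: algebra_simps mult_monom)
  qed (simp add: even_geometric_def numeral_2_eq_2)
  have "poly ((monom 1 2 - 1) * even_geometric m) z = z ^ (2 * m + 2) - 1"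
    unfolding eq by (simp add: poly_monom)
  then have "z \<noteq> 0" using z by auto
  have "poly (pderiv ((monom 1 2 - 1) * even_geometric m)) z = of_nat (2 * m + 2) * z ^ (2 * m + 1)"
    unfolding eq by (simp add: pderiv_diff pderiv_monom poly_monom)
  moreover have "poly (pderiv ((monom 1 2 - 1) * even_geometric m)) z = 0"
    using z by (simp add: pderiv_mult)
  ultimately show False using \<open>z \<noteq> 0\<close> by (metis mult_eq_0_iff of_nat_eq_0_iff power_eq_0_iff add_is_0 zero_neq_numeral)
qed

lemma even_geometric_consecutive: "\<not> common_root (even_geometric m) (even_geometric (Suc m)) z"
proof
  assume z: "common_root (even_geometric m) (even_geometric (Suc m)) z"
  have "poly (even_geometric (Suc m)) z = poly (even_geometric m) z + z ^ (2 * Suc m)"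
    by (simp add: poly_even_geometric)
  then have "z ^ (2 * Suc m) = 0" using z by simp
  then have "z = 0" by (metis power_eq_0_iff)
  then show False using z poly_even_geometric_special(1) by blast
qed

lemma finite_affine_roots:
  fixes c d :: complex
  assumes "c \<noteq> 0 \<or> d \<noteq> 0"
  shows "finite {t. c + t * d = 0}"
proof -
  have "finite {t. poly [:c, d:] t = 0}" using assms by (intro poly_roots_finite) auto
  then show ?thesis by simp
qed

text \<open>A polynomial in \<open>t\<close> whose coefficients are polynomials in \<open>w\<close> and polynomial functions of the
  parameter.\<close>
definition poly_family2 :: "'i set \<Rightarrow> (('i \<Rightarrow> complex) \<Rightarrow> complex \<Rightarrow> complex poly) \<Rightarrow> bool" where
  "poly_family2 I \<Phi> \<longleftrightarrow> (\<forall>j. \<exists>F. poly_family I F \<and> (\<forall>u w. poly (F u) w = coeff (\<Phi> u w) j))"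

lemma poly_family2_linear_factor:
  assumes "poly_family2 I \<Phi>"
  shows "poly_family2 I (\<lambda>u w. [:1, 1:] * \<Phi> u w)"
  unfolding poly_family2_def
proof
  fix j
  obtain F where F: "\<And>j. poly_family I (F j)" "\<And>j u w. poly (F j u) w = coeff (\<Phi> u w) j"
    using assms unfolding poly_family2_def by metis
  have "poly_family I (\<lambda>u. if j = 0 then 0 else F (j - 1) u)"
    by (cases "j = 0") (simp_all add: F poly_family_const)
  then show "\<exists>F. poly_family I F \<and> (\<forall>u w. poly (F u) w = coeff ([:1, 1:] * \<Phi> u w) j)"
    by (intro exI[of _ "\<lambda>u. F j u + (if j = 0 then 0 else F (j - 1) u)"] conjI poly_family_add F(1))
      (auto simp: F coeff_pCons split: nat.splits)
qed

lemma poly_family2_synthetic_div: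
  assumes "poly_family2 I \<Phi>" "\<And>u w. degree (\<Phi> u w) \<le> m"
  shows "poly_family2 I (\<lambda>u w. synthetic_div (\<Phi> u w) w)"
  unfolding poly_family2_def
proof
  fix j
  obtain F where F: "\<And>j. poly_family I (F j)" "\<And>j u w. poly (F j u) w = coeff (\<Phi> u w) j"
    using assms(1) unfolding poly_family2_def by metis
  show "\<exists>F. poly_family I F \<and> (\<forall>u w. poly (F u) w = coeff (synthetic_div (\<Phi> u w) w) j)"
    by (intro exI[of _ "\<lambda>u. \<Sum>k\<in>{j<..m}. F k u * monom 1 (k - 1 - j)"] conjI poly_family_sum
        poly_family_mult poly_family_const F(1))
      (simp add: F coeff_synthetic_div[OF assms(2)] poly_sum poly_monom)
qed

lemma poly_family2_resultant:
  assumes "poly_family2 I \<Phi>" "poly_family2 I \<Psi>"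
  shows "\<exists>R. poly_family I R \<and> (\<forall>u w. poly (R u) w = poly_resultant D (\<Phi> u w) (\<Psi> u w))"
proof -
  obtain F where F: "\<And>j. poly_family I (F j)" "\<And>j u w. poly (F j u) w = coeff (\<Phi> u w) j"
    using assms(1) unfolding poly_family2_def by metis
  obtain G where G: "\<And>j. poly_family I (G j)" "\<And>j u w. poly (G j u) w = coeff (\<Psi> u w) j"
    using assms(2) unfolding poly_family2_def by metis
  have "poly_family I (\<lambda>u. if even j then F (j div 2) u else G (j div 2) u)" for j
    by (cases "even j") (simp_all add: F G)
  from poly_family_compose[OF hurwitz_Gamma_bar_polyfuns[of "2 * D + 1"],
      of I "\<lambda>j u. if even j then F (j div 2) u else G (j div 2) u", OF _ this]
  obtain R where "poly_family I R" "\<forall>u w. poly (R u) w = hurwitz_Gamma_bar (2 * D + 1)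
      (\<lambda>j. poly (if even j then F (j div 2) u else G (j div 2) u) w)"
    by auto
  moreover have "(\<lambda>j. poly (if even j then F (j div 2) u else G (j div 2) u) w) =
      (\<lambda>j. if even j then coeff (\<Phi> u w) (j div 2) else coeff (\<Psi> u w) (j div 2))" for u w
    by (auto simp: F G)
  ultimately show ?thesis unfolding poly_resultant_def by auto
qed

section \<open>Critical points as roots of one polynomial\<close>

text \<open>The polynomials \<open>E1\<close>, \<open>E2\<close> are what remains of the squared denominators of the two
  summands of the distance function after their common factors are removed; the latter are
  collected in \<open>L\<close>.\<close>
locale hurwitz_distance = hurwitz_hypersurface +
  fixes E1 E2 L A B :: "complex poly"
  defines A_def: "A \<equiv> monom 1 (2 * \<delta>) * even_geometric (n div 2 - \<delta>)"
    and B_def: "B \<equiv> even_geometric ((n - 1) div 2)"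
  assumes E1: "L * E1 = monom 1 \<delta> * B\<^sup>2" and E2: "L * E2 = A\<^sup>2"
    and E_coprime: "\<And>z. \<not> common_root E1 E2 z"
begin

lemma poly_A: "poly A w = (\<Sum>k\<in>{\<delta>..a}. w ^ (2 * k))"
proof -
  have "poly A w = (\<Sum>k\<le>a - \<delta>. w ^ (2 * (k + \<delta>)))"
    by (simp add: A_def poly_monom poly_even_geometric sum_distrib_left power_add distrib_left mult.commute)
  also have "\<dots> = (\<Sum>k\<in>{\<delta>..a}. w ^ (2 * k))"
  proof -
    have "(\<Sum>k\<le>m - \<delta>. w ^ (2 * (k + \<delta>))) = (\<Sum>k\<in>{\<delta>..m}. w ^ (2 * k))" if "\<delta> \<le> m" for m
      using that by (intro sum.reindex_bij_witness[of _ "\<lambda>k. k - \<delta>" "\<lambda>k. k + \<delta>"]) auto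
    then show ?thesis using \<delta> ab(1) le_trans by blast
  qed
  finally show ?thesis .
qed

lemma A_alt: "A = (\<Sum>k\<in>{\<delta>..a}. monom 1 (2 * k))"
  by (intro poly_eq_poly_eq_iff[THEN iffD1] ext) (simp add: poly_A poly_sum poly_monom)

lemma A_nonzero: "A \<noteq> 0" and B_nonzero: "B \<noteq> 0"
  by (simp_all add: A_def B_def even_geometric_nonzero)

lemma degree_A: "degree A = 2 * a" and degree_B: "degree B = 2 * b"
proof -
  have "degree A = 2 * \<delta> + 2 * (a - \<delta>)"
    unfolding A_def using even_geometric_nonzero
    by (subst degree_mult_eq) (auto simp: degree_monom_eq degree_even_geometric)
  moreover have "2 * \<delta> + 2 * (k - \<delta>) = 2 * k" if "k \<ge> 1" for k using that \<delta> by simp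
  note this[OF ab(1)]
  ultimately show "degree A = 2 * a" by (simp only:)
  show "degree B = 2 * b" by (simp add: B_def degree_even_geometric)
qed

lemma A_root: "poly A z = 0 \<Longrightarrow> poly (pderiv A) z = 0 \<Longrightarrow> \<delta> = 1 \<and> z = 0"
proof -
  assume z: "poly A z = 0" "poly (pderiv A) z = 0"
  have "z ^ (2 * \<delta>) = 0"
  proof (rule ccontr)
    assume nz: "z ^ (2 * \<delta>) \<noteq> 0"
    let ?S = "even_geometric (a - \<delta>)"
    have "z ^ (2 * \<delta>) * poly ?S z = 0"
      using z(1) by (simp only: A_def poly_mult poly_monom mult_1)
    then have S: "poly ?S z = 0" using nz mult_eq_0_iff by blast
    then have "z ^ (2 * \<delta>) * poly (pderiv ?S) z = 0"
      using z(2) by (simp only: A_def pderiv_mult poly_add poly_mult poly_monom mult_1 mult_zero_left add_0_right)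
    then have "poly (pderiv ?S) z = 0" using nz mult_eq_0_iff by blast
    then show False using even_geometric_squarefree S by blast
  qed
  then show ?thesis using \<delta> by (cases "\<delta> = 0") auto
qed

abbreviation "KP u \<equiv> quotient_numerator (P u) A"
abbreviation "KQ u \<equiv> quotient_numerator (Q u) B"

text \<open>If \<open>\<delta> = 1\<close>, then \<open>A\<close> has a double root at \<open>0\<close>, which makes \<open>KP u\<close> divisible by the
  variable; this is the quotient.\<close>
definition KPr :: "(nat \<Rightarrow> complex) \<Rightarrow> complex poly" where
  "KPr u = Polynomial.smult 2 (monom 1 \<delta> * pderiv (P u) * even_geometric (a - \<delta>)) -
     P u * (Polynomial.smult (2 * of_nat \<delta>) (even_geometric (a - \<delta>)) +
       monom 1 \<delta> * pderiv (even_geometric (a - \<delta>)))"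

lemma KPr: "monom 1 \<delta> * KPr u = KP u"
proof -
  let ?S = "even_geometric (a - \<delta>)"
  have pd: "pderiv A = Polynomial.smult (2 * of_nat \<delta>) (monom 1 \<delta> * ?S) + monom 1 (2 * \<delta>) * pderiv ?S"
  proof (cases "\<delta> = 0")
    case True
    then show ?thesis by (simp add: A_def)
  next
    case False
    then have "\<delta> = 1" using \<delta> by simp
    then show ?thesis
      by (simp add: A_def pderiv_mult pderiv_monom smult_monom add.commute flip: mult_smult_left)
  qed
  have m: "monom (1 :: complex) (2 * \<delta>) = monom 1 \<delta> * monom 1 \<delta>" by (simp add: mult_monom mult_2)
  show ?thesis
    unfolding quotient_numerator_def pd KPr_def unfolding A_def m by (simp add: algebra_simps)
qed

text \<open>The numerator of the derivative of \<open>(P u)\<^sup>2 / A + (Q u)\<^sup>2 / B\<close>, which is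
  \<open>P u * KP u / A\<^sup>2 + Q u * KQ u / B\<^sup>2\<close>, after cancellation of the common factor \<open>L\<close>.\<close>
definition critical_poly :: "(nat \<Rightarrow> complex) \<Rightarrow> complex poly" where
  "critical_poly u = P u * KPr u * E1 + Q u * KQ u * E2"

definition ed_degree :: nat where
  "ed_degree = 4 * a - 2 - \<delta> + degree E1"

lemma critical_poly_eq: "L * critical_poly u = P u * KP u * B\<^sup>2 + Q u * KQ u * A\<^sup>2"
proof -
  have "L * critical_poly u = P u * KPr u * (L * E1) + Q u * KQ u * (L * E2)"
    by (simp add: critical_poly_def algebra_simps)
  also have "\<dots> = P u * KP u * B\<^sup>2 + Q u * KQ u * A\<^sup>2"
    unfolding E1 E2 KPr[symmetric] by (simp add: algebra_simps)
  finally show ?thesis .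
qed

lemma L_nonzero_at: "poly A w \<noteq> 0 \<Longrightarrow> poly L w \<noteq> 0"
  using arg_cong[OF E2, of "\<lambda>p. poly p w"] by auto

lemma even_powers_affine: "even_powers w \<in> affine_space I"
  and odd_powers_affine: "odd_powers w \<in> affine_space I"
  by (auto simp: even_powers_def odd_powers_def affine_space_def)

lemma even_part_odd_powers: "even_part n (odd_powers w) = 0"
  and odd_part_even_powers: "odd_part n (even_powers w) = 0"
  by (rule poly_eqI; simp add: coeff_even_part coeff_odd_part even_powers_def odd_powers_def)+

lemma coeff_even_powers: "coeff (even_part n (even_powers w)) k = (if \<delta> \<le> k \<and> k \<le> a then w ^ k else 0)"
proof -
  have "\<delta> \<le> 2 * k \<longleftrightarrow> \<delta> \<le> k" using \<delta> by presburger
  moreover have "2 * k \<le> n \<longleftrightarrow> k \<le> a" by presburger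
  ultimately show ?thesis by (simp add: coeff_even_part even_powers_def)
qed

lemma coeff_odd_powers: "coeff (odd_part n (odd_powers w)) k = (if k \<le> b then w ^ k else 0)"
proof -
  have "\<delta> \<le> 2 * k + 1" using \<delta> by simp
  moreover have "2 * k + 1 \<le> n \<longleftrightarrow> k \<le> b" using n by linarith
  ultimately show ?thesis by (simp add: coeff_odd_part odd_powers_def)
qed

lemma poly_even_powers: "poly (even_part n (even_powers w)) w = poly A w"
proof -
  have "even_part n (even_powers w) = (\<Sum>k\<in>{\<delta>..a}. monom (w ^ k) k)"
    by (rule poly_eqI) (simp add: coeff_even_powers coeff_sum)
  then show ?thesis by (simp add: poly_A poly_sum poly_monom mult_2 power_add)
qed

lemma poly_odd_powers: "poly (odd_part n (odd_powers w)) w = poly B w"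
proof -
  have "odd_part n (odd_powers w) = (\<Sum>k\<le>b. monom (w ^ k) k)"
    by (rule poly_eqI) (simp add: coeff_odd_powers coeff_sum)
  then show ?thesis by (simp add: B_def poly_even_geometric poly_sum poly_monom mult_2 power_add)
qed

text \<open>By symmetry, the derivative of the bilinear form in one argument is half that of the
  quadratic form.\<close>
lemma pderiv_even_powers: "2 * poly (pderiv (even_part n (even_powers w))) w = poly (pderiv A) w"
proof -
  have eq: "even_part n (even_powers w) = (\<Sum>k\<in>{\<delta>..a}. monom (w ^ k) k)"
    by (rule poly_eqI) (simp add: coeff_even_powers coeff_sum)
  have key: "2 * (of_nat k * w ^ k * w ^ (k - 1)) = of_nat (2 * k) * w ^ (2 * k - 1)" for k
  proof (cases "k = 0")
    case False
    then have "k + (k - 1) = 2 * k - 1" by simp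
    then have "w ^ k * w ^ (k - 1) = w ^ (2 * k - 1)" by (metis power_add)
    then show ?thesis by (simp add: mult.assoc)
  qed simp
  have "2 * poly (pderiv (even_part n (even_powers w))) w = (\<Sum>k\<in>{\<delta>..a}. 2 * (of_nat k * w ^ k * w ^ (k - 1)))"
    unfolding eq by (simp add: pderiv_sum_poly pderiv_monom poly_sum poly_monom sum_distrib_left)
  also have "\<dots> = (\<Sum>k\<in>{\<delta>..a}. of_nat (2 * k) * w ^ (2 * k - 1))"
    by (rule sum.cong[OF refl key])
  also have "\<dots> = poly (pderiv A) w"
    unfolding A_alt by (simp add: pderiv_sum_poly pderiv_monom poly_sum poly_monom)
  finally show ?thesis .
qed

lemma pderiv_odd_powers: "2 * poly (pderiv (odd_part n (odd_powers w))) w = poly (pderiv B) w"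
proof -
  have eq: "odd_part n (odd_powers w) = (\<Sum>k\<le>b. monom (w ^ k) k)"
    by (rule poly_eqI) (simp add: coeff_odd_powers coeff_sum)
  have key: "2 * (of_nat k * w ^ k * w ^ (k - 1)) = of_nat (2 * k) * w ^ (2 * k - 1)" for k
  proof (cases "k = 0")
    case False
    then have "k + (k - 1) = 2 * k - 1" by simp
    then have "w ^ k * w ^ (k - 1) = w ^ (2 * k - 1)" by (metis power_add)
    then show ?thesis by (simp add: mult.assoc)
  qed simp
  have "2 * poly (pderiv (odd_part n (odd_powers w))) w = (\<Sum>k\<le>b. 2 * (of_nat k * w ^ k * w ^ (k - 1)))"
    unfolding eq by (simp add: pderiv_sum_poly pderiv_monom poly_sum poly_monom sum_distrib_left)
  also have "\<dots> = (\<Sum>k\<le>b. of_nat (2 * k) * w ^ (2 * k - 1))"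
    by (rule sum.cong[OF refl key])
  also have "\<dots> = poly (pderiv B) w"
    unfolding B_def even_geometric_def by (simp add: pderiv_sum_poly pderiv_monom poly_sum poly_monom)
  finally show ?thesis .
qed

lemma even_part_of_sum:
  "P (\<lambda>i. x i + (\<alpha> * even_powers w i + \<beta> * odd_powers w i)) =
     P x + Polynomial.smult \<alpha> (even_part n (even_powers w))"
proof -
  have aff: "(\<lambda>i. \<alpha> * even_powers w i + \<beta> * odd_powers w i) \<in> affine_space I"
    by (intro affine_space_combination even_powers_affine odd_powers_affine)
  show ?thesis
    using hat_perturbation[OF aff, of x 1] even_part_combination[of n 1 "hat x" 1
        "\<lambda>i. \<alpha> * even_powers w i + \<beta> * odd_powers w i"]
    by (simp add: even_part_combination even_part_odd_powers)
qed

lemma odd_part_of_sum: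
  "Q (\<lambda>i. x i + (\<alpha> * even_powers w i + \<beta> * odd_powers w i)) =
     Q x + Polynomial.smult \<beta> (odd_part n (odd_powers w))"
  using odd_part_combination[of n 1 x 1 "\<lambda>i. \<alpha> * even_powers w i + \<beta> * odd_powers w i"]
  by (simp add: odd_part_combination odd_part_even_powers)

lemma inner_even_powers:
  assumes "v \<in> affine_space I"
  shows "bilinear_form I (even_powers w) v = poly (even_part n v) w"
proof -
  have "bilinear_form I (even_powers w) v = (\<Sum>i\<in>(\<lambda>k. 2 * k) ` {..a}. v i * w ^ (i div 2))"
    unfolding bilinear_form_def using assms
    by (intro sum.mono_neutral_cong) (auto simp: even_powers_def affine_space_def elim!: evenE)
  also have "\<dots> = poly (even_part n v) w"
    unfolding poly_even_part by (subst sum.reindex) (auto simp: inj_on_def)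
  finally show ?thesis .
qed

lemma inner_odd_powers:
  assumes "v \<in> affine_space I"
  shows "bilinear_form I (odd_powers w) v = poly (odd_part n v) w"
proof -
  have img: "(\<lambda>k. 2 * k + 1) ` {..b} = {i. odd i \<and> i \<le> n}"
  proof (intro equalityI subsetI)
    fix i assume "i \<in> {i. odd i \<and> i \<le> n}"
    then obtain k where k: "i = 2 * k + 1" "i \<le> n" by (auto elim: oddE)
    then have "k \<le> b" by simp
    then show "i \<in> (\<lambda>k. 2 * k + 1) ` {..b}" using k(1) by blast
  qed (use ab(7) in auto)
  have "bilinear_form I (odd_powers w) v = (\<Sum>i\<in>{i. odd i \<and> i \<le> n}. v i * w ^ (i div 2))"
    unfolding bilinear_form_def using assms
    by (intro sum.mono_neutral_cong) (auto simp: odd_powers_def affine_space_def)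
  also have "\<dots> = (\<Sum>i\<in>(\<lambda>k. 2 * k + 1) ` {..b}. v i * w ^ (i div 2))" unfolding img ..
  also have "\<dots> = poly (odd_part n v) w"
    unfolding poly_odd_part by (subst sum.reindex) (auto simp: inj_on_def)
  finally show ?thesis .
qed

text \<open>The foot of the perpendicular from \<open>u\<close> to the linear space of points with common root \<open>w\<close>.\<close>
definition candidate :: "(nat \<Rightarrow> complex) \<Rightarrow> complex \<Rightarrow> nat \<Rightarrow> complex" where
  "candidate u w = (\<lambda>i. u i + (- (poly (P u) w / poly A w) * even_powers w i
     + - (poly (Q u) w / poly B w) * odd_powers w i))"

text \<open>The residues are the even and the odd part of the candidate, cleared of denominators, and the
  cofactors are their quotients by \<open>t - w\<close>.\<close>
definition even_residue :: "(nat \<Rightarrow> complex) \<Rightarrow> complex \<Rightarrow> complex poly" where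
  "even_residue u w = Polynomial.smult (poly A w) (P u)
     - Polynomial.smult (poly (P u) w) (even_part n (even_powers w))"

definition odd_residue :: "(nat \<Rightarrow> complex) \<Rightarrow> complex \<Rightarrow> complex poly" where
  "odd_residue u w = Polynomial.smult (poly B w) (Q u)
     - Polynomial.smult (poly (Q u) w) (odd_part n (odd_powers w))"

definition even_cofactor :: "(nat \<Rightarrow> complex) \<Rightarrow> complex \<Rightarrow> complex poly" where
  "even_cofactor u w = synthetic_div (even_residue u w) w"

definition odd_cofactor :: "(nat \<Rightarrow> complex) \<Rightarrow> complex \<Rightarrow> complex poly" where
  "odd_cofactor u w = synthetic_div (odd_residue u w) w"

lemma even_residue_factor: "even_residue u w = [:-w, 1:] * even_cofactor u w"
  unfolding even_cofactor_def
  by (rule synthetic_div_root[symmetric]) (simp add: even_residue_def poly_even_powers)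

lemma odd_residue_factor: "odd_residue u w = [:-w, 1:] * odd_cofactor u w"
  unfolding odd_cofactor_def
  by (rule synthetic_div_root[symmetric]) (simp add: odd_residue_def poly_odd_powers)

lemma degree_even_residue: "degree (even_residue u w) \<le> a"
  unfolding even_residue_def
  by (intro degree_diff_le order_trans[OF degree_smult_le] degree_even_part)

lemma degree_odd_residue: "degree (odd_residue u w) \<le> b"
  unfolding odd_residue_def
  by (intro degree_diff_le order_trans[OF degree_smult_le] degree_odd_part)

lemma degree_even_cofactor: "degree (even_cofactor u w) \<le> a - 1"
  unfolding even_cofactor_def degree_synthetic_div by (rule diff_le_mono[OF degree_even_residue])

lemma degree_odd_cofactor: "degree (odd_cofactor u w) \<le> b - 1"
  unfolding odd_cofactor_def degree_synthetic_div by (rule diff_le_mono[OF degree_odd_residue])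

lemma even_cofactor_at: "2 * poly (even_cofactor u w) w = poly (KP u) w"
proof -
  have "poly (even_cofactor u w) w = poly (pderiv (even_residue u w)) w"
    unfolding even_residue_factor by (simp add: pderiv_mult pderiv_pCons del: mult_pCons_left)
  also have "\<dots> = poly A w * poly (pderiv (P u)) w -
      poly (P u) w * poly (pderiv (even_part n (even_powers w))) w"
    by (simp add: even_residue_def pderiv_diff pderiv_smult)
  finally have eq: "poly (even_cofactor u w) w = poly A w * poly (pderiv (P u)) w -
      poly (P u) w * poly (pderiv (even_part n (even_powers w))) w" .
  show ?thesis
    unfolding eq by (simp add: quotient_numerator_def pderiv_even_powers[symmetric] algebra_simps)
qed

lemma odd_cofactor_at: "2 * poly (odd_cofactor u w) w = poly (KQ u) w"
proof -
  have "poly (odd_cofactor u w) w = poly (pderiv (odd_residue u w)) w"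
    unfolding odd_residue_factor by (simp add: pderiv_mult pderiv_pCons del: mult_pCons_left)
  also have "\<dots> = poly B w * poly (pderiv (Q u)) w -
      poly (Q u) w * poly (pderiv (odd_part n (odd_powers w))) w"
    by (simp add: odd_residue_def pderiv_diff pderiv_smult)
  finally have eq: "poly (odd_cofactor u w) w = poly B w * poly (pderiv (Q u)) w -
      poly (Q u) w * poly (pderiv (odd_part n (odd_powers w))) w" .
  show ?thesis
    unfolding eq by (simp add: quotient_numerator_def pderiv_odd_powers[symmetric] algebra_simps)
qed

lemma candidate_parts:
  assumes w: "poly A w \<noteq> 0" "poly B w \<noteq> 0"
  shows "P (candidate u w) = [:-w, 1:] * Polynomial.smult (inverse (poly A w)) (even_cofactor u w)"
    and "Q (candidate u w) = [:-w, 1:] * Polynomial.smult (inverse (poly B w)) (odd_cofactor u w)"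
proof -
  have "P (candidate u w) = Polynomial.smult (inverse (poly A w)) (even_residue u w)"
    unfolding candidate_def even_part_of_sum even_residue_def
    using w by (simp add: smult_diff_right divide_inverse mult.commute)
  then show "P (candidate u w) = [:-w, 1:] * Polynomial.smult (inverse (poly A w)) (even_cofactor u w)"
    by (simp only: even_residue_factor mult_smult_right)
  have "Q (candidate u w) = Polynomial.smult (inverse (poly B w)) (odd_residue u w)"
    unfolding candidate_def odd_part_of_sum odd_residue_def
    using w by (simp add: smult_diff_right divide_inverse mult.commute)
  then show "Q (candidate u w) = [:-w, 1:] * Polynomial.smult (inverse (poly B w)) (odd_cofactor u w)"
    by (simp only: odd_residue_factor mult_smult_right)
qed

text \<open>Nondegeneracy of the candidate: its two parts have no common root besides \<open>w\<close>, which is a simple one,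
  and its even part has full degree.  The factor \<open>t + 1\<close> raises the formal degree to \<open>a \<ge> 1\<close>; the
  price is the extra condition that the odd cofactor does not vanish at \<open>-1\<close>.\<close>
definition nondegenerate :: "(nat \<Rightarrow> complex) \<Rightarrow> complex \<Rightarrow> bool" where
  "nondegenerate u w \<longleftrightarrow> poly_resultant a ([:1, 1:] * even_cofactor u w) (odd_cofactor u w) \<noteq> 0"

lemma nondegenerate_iff:
  "nondegenerate u w \<longleftrightarrow>
     (\<forall>z. \<not> common_root ([:1, 1:] * even_cofactor u w) (odd_cofactor u w) z) \<and>
     coeff (even_cofactor u w) (a - 1) \<noteq> 0"
proof -
  have e: "degree (even_cofactor u w) < a" using degree_even_cofactor[of u w] ab(1) by linarith
  have o: "degree (odd_cofactor u w) < a" using degree_odd_cofactor[of u w] ab(2,3) by linarith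
  have "degree [:1, 1 :: complex:] = 1" by simp
  then have E: "degree ([:1, 1:] * even_cofactor u w) \<le> a"
    using degree_mult_le[of "[:1, 1:]" "even_cofactor u w"] e by linarith
  have factor: "coeff ([:1, 1:] * q) m = coeff q (m - 1)" if "coeff q m = 0" "m \<ge> 1" for m and q :: "complex poly"
    using that by (cases m) auto
  have "coeff ([:1, 1:] * even_cofactor u w) a = coeff (even_cofactor u w) (a - 1)"
    by (rule factor[OF coeff_eq_0[OF e] ab(1)])
  moreover note coeff_eq_0[OF o]
  ultimately show ?thesis
    unfolding nondegenerate_def poly_resultant_eq_0_iff[OF ab(1) E less_imp_le[OF o]] by metis
qed

lemma nondegenerate_cofactors:
  assumes "nondegenerate u w"
  shows "\<not> common_root (even_cofactor u w) (odd_cofactor u w) z" "coeff (even_cofactor u w) (a - 1) \<noteq> 0"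
  using assms unfolding nondegenerate_iff by auto

text \<open>If the derivative of the determinant along \<open>v\<close> vanishes, then \<open>v\<close> is orthogonal to the normal
  vector with components proportional to the odd and the negative even cofactor at \<open>w\<close>.\<close>
lemma gradient_relation:
  assumes w: "poly A w \<noteq> 0" "poly B w \<noteq> 0" and nd: "nondegenerate u w"
    and v: "v \<in> affine_space I" and zero: "(\<Sum>i\<in>I. partial_deriv i \<Gamma> (candidate u w) * v i) = 0"
  shows "poly (odd_cofactor u w) w / poly B w * poly (even_part n v) w =
    poly (even_cofactor u w) w / poly A w * poly (odd_part n v) w"
proof -
  let ?x = "candidate u w"
  let ?p = "Polynomial.smult (inverse (poly A w)) (even_cofactor u w)"
  let ?q = "Polynomial.smult (inverse (poly B w)) (odd_cofactor u w)"
  note parts = candidate_parts[OF w, of u]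
  have Q: "odd_part n (hat ?x) = [:-w, 1:] * ?q" using parts(2) by (simp add: odd_part_hat)
  have n2: "n \<ge> 2" using n by simp
  have root: "common_root (P ?x) (odd_part n (hat ?x)) w" by (simp add: parts(1) Q)
  have "((\<lambda>s. \<Gamma> (\<lambda>i. ?x i + s * v i)) has_field_derivative
      (\<Sum>i\<in>I. partial_deriv i \<Gamma> (\<lambda>i. ?x i + 0 * v i) * v i)) (at 0)"
    by (rule polyfuns_chain_rule[OF Gamma_polyfuns]) (auto intro!: derivative_eq_intros)
  then have "((\<lambda>s. hurwitz_Gamma_bar n (\<lambda>i. hat ?x i + s * v i)) has_field_derivative 0) (at 0)"
    using zero by (simp add: hat_perturbation[OF v])
  with hurwitz_Gamma_bar_directional_derivative[OF n2 root, of v]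
  have "Determinant.det (kernel_column_mat n (hat ?x) v w) = 0" using DERIV_unique by blast
  from hurwitz_Gamma_bar_derivative_zero[OF n2 parts(1) Q _ _ this]
  have "poly ?q w * poly (even_part n v) w = poly ?p w * poly (odd_part n v) w"
    using nondegenerate_cofactors[OF nd] w by auto
  then show ?thesis by (simp add: divide_inverse mult.commute)
qed

text \<open>Unless both cofactors vanish at \<open>w\<close>, not every direction satisfies the relation above, so the
  candidate is a smooth point; and at a root of the critical polynomial the relation makes
  \<open>u - candidate u w\<close> orthogonal to the tangent space.\<close>
lemma candidate_critical:
  assumes u: "u \<in> affine_space I" and w: "poly A w \<noteq> 0" "poly B w \<noteq> 0" and nd: "nondegenerate u w"
    and root: "poly (critical_poly u) w = 0"
  shows "candidate u w \<in> critical_points I X u"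
proof -
  let ?x = "candidate u w"
  define p where "p = poly (even_cofactor u w) w / poly A w"
  define q where "q = poly (odd_cofactor u w) w / poly B w"
  define \<alpha> where "\<alpha> = poly (P u) w / poly A w"
  define \<beta> where "\<beta> = poly (Q u) w / poly B w"
  have pq: "p \<noteq> 0 \<or> q \<noteq> 0"
    using nondegenerate_cofactors(1)[OF nd, of w] w by (auto simp: p_def q_def)
  have aff: "?x \<in> affine_space I"
    using affine_space_combination[OF u affine_space_combination[OF even_powers_affine odd_powers_affine],
        of 1 1 "- \<alpha>" w "- \<beta>" w]
    by (simp add: candidate_def \<alpha>_def \<beta>_def)
  have roots: "common_root (P ?x) (Q ?x) w" using candidate_parts[OF w, of u] by simp
  then have X: "?x \<in> X" using aff Gamma_eq_0_iff by (auto simp: hypersurface_def)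
  have ideal: "\<Gamma> \<in> vanishing_ideal I X"
    using Gamma_polyfuns by (auto simp: vanishing_ideal_def hypersurface_def)
  have rel: "q * poly (even_part n v) w = p * poly (odd_part n v) w"
    if "v \<in> affine_space I" "(\<Sum>i\<in>I. partial_deriv i \<Gamma> ?x * v i) = 0" for v
    using gradient_relation[OF w nd that] by (simp add: p_def q_def)
  have "?x \<notin> hypersurface_sing I X"
  proof
    assume "?x \<in> hypersurface_sing I X"
    then have "\<forall>i\<in>I. partial_deriv i \<Gamma> ?x = 0" using ideal by (auto simp: hypersurface_sing_def)
    then have zero: "(\<Sum>i\<in>I. partial_deriv i \<Gamma> ?x * v i) = 0" for v by simp
    have idx: "1 \<in> I" "2 * \<delta> \<in> I" "2 * \<delta> \<le> n" using n \<delta> by auto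
    have "p = 0"
      using rel[OF affine_space_unit[OF idx(1)] zero] n
      by (simp add: poly_even_part_unit poly_odd_part_unit)
    moreover have nz: "w ^ \<delta> \<noteq> 0" using root_nonzero[of ?x w] roots \<delta> by (cases "\<delta> = 0") auto
    have "q * w ^ \<delta> = 0"
      using rel[OF affine_space_unit[OF idx(2)] zero] n idx(3)
      by (simp add: poly_even_part_unit poly_odd_part_unit)
    then have "q = 0" using nz mult_eq_0_iff by blast
    ultimately show False using pq by simp
  qed
  moreover have "bilinear_form I (\<lambda>i. u i - ?x i) v = 0" if v: "v \<in> tangent_space I X ?x" for v
  proof -
    have v_aff: "v \<in> affine_space I" using v by (simp add: tangent_space_def)
    have zero: "(\<Sum>i\<in>I. partial_deriv i \<Gamma> ?x * v i) = 0"
      using v ideal unfolding tangent_space_def by blast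
    have crit: "\<alpha> * p + \<beta> * q = 0"
    proof -
      have "poly (P u) w * poly (KP u) w * (poly B w)\<^sup>2 + poly (Q u) w * poly (KQ u) w * (poly A w)\<^sup>2 = 0"
        using arg_cong[OF critical_poly_eq[of u], of "\<lambda>p. poly p w"] root by simp
      then have "2 * (poly (P u) w * poly (even_cofactor u w) w * (poly B w)\<^sup>2 +
          poly (Q u) w * poly (odd_cofactor u w) w * (poly A w)\<^sup>2) = 0"
        unfolding even_cofactor_at[symmetric] odd_cofactor_at[symmetric] by (simp only: distrib_left mult_ac)
      then have "poly (P u) w * poly (even_cofactor u w) w * (poly B w)\<^sup>2 +
          poly (Q u) w * poly (odd_cofactor u w) w * (poly A w)\<^sup>2 = 0"
        by (metis mult_eq_0_iff zero_neq_numeral)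
      then show ?thesis
        using w by (simp add: \<alpha>_def \<beta>_def p_def q_def field_simps power2_eq_square)
    qed
    have "bilinear_form I (\<lambda>i. u i - ?x i) v =
        bilinear_form I (\<lambda>i. \<alpha> * even_powers w i + \<beta> * odd_powers w i) v"
      by (simp add: candidate_def \<alpha>_def \<beta>_def algebra_simps)
    also have "\<dots> = \<alpha> * bilinear_form I (even_powers w) v + \<beta> * bilinear_form I (odd_powers w) v"
      by (simp add: bilinear_form_def sum.distrib sum_distrib_left algebra_simps)
    also have "\<dots> = \<alpha> * poly (even_part n v) w + \<beta> * poly (odd_part n v) w"
      by (simp add: inner_even_powers[OF v_aff] inner_odd_powers[OF v_aff])
    also have "\<dots> = 0"
    proof -
      note r = rel[OF v_aff zero]
      have "p * (\<alpha> * poly (even_part n v) w + \<beta> * poly (odd_part n v) w) =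
          \<alpha> * p * poly (even_part n v) w + \<beta> * (p * poly (odd_part n v) w)" by (simp add: algebra_simps)
      also have "\<dots> = (\<alpha> * p + \<beta> * q) * poly (even_part n v) w"
        unfolding r[symmetric] by (simp add: algebra_simps)
      finally have "p * (\<alpha> * poly (even_part n v) w + \<beta> * poly (odd_part n v) w) = 0" using crit by simp
      moreover have "q * (\<alpha> * poly (even_part n v) w + \<beta> * poly (odd_part n v) w) =
          \<alpha> * (q * poly (even_part n v) w) + \<beta> * q * poly (odd_part n v) w" by (simp add: algebra_simps)
      then have "q * (\<alpha> * poly (even_part n v) w + \<beta> * poly (odd_part n v) w) =
          (\<alpha> * p + \<beta> * q) * poly (odd_part n v) w"
        unfolding r by (simp add: algebra_simps)
      then have "q * (\<alpha> * poly (even_part n v) w + \<beta> * poly (odd_part n v) w) = 0" using crit by simp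
      ultimately show ?thesis using pq by auto
    qed
    finally show ?thesis .
  qed
  ultimately show ?thesis using X by (simp add: critical_points_def)
qed

text \<open>If \<open>w\<close> were isotropic for one of the two norms, then the corresponding value of \<open>P u\<close> or \<open>Q u\<close>
  would vanish, and with it both summands of the critical polynomial.\<close>
lemma critical_is_candidate:
  assumes u: "u \<in> affine_space I" and x: "x \<in> critical_points I X u"
    and w: "common_root (P x) (Q x) w"
    and gen: "\<And>z. \<not> common_root (critical_poly u) (A * B) z"
  shows "poly (critical_poly u) w = 0 \<and> x = candidate u w"
proof -
  obtain \<alpha> \<beta> where ux: "u = (\<lambda>i. x i + (\<alpha> * even_powers w i + \<beta> * odd_powers w i))"
    and crit: "\<alpha> * poly (pderiv (P x)) w + \<beta> * poly (pderiv (Q x)) w = 0"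
    by (rule critical_point_finite[OF u x w])
  have Pu: "P u = P x + Polynomial.smult \<alpha> (even_part n (even_powers w))"
    using even_part_of_sum[of x \<alpha> w \<beta>] ux by simp
  have Qu: "Q u = Q x + Polynomial.smult \<beta> (odd_part n (odd_powers w))"
    using odd_part_of_sum[of x \<alpha> w \<beta>] ux by simp
  have Pw: "poly (P u) w = \<alpha> * poly A w" using w by (simp add: Pu poly_even_powers)
  have Qw: "poly (Q u) w = \<beta> * poly B w" using w by (simp add: Qu poly_odd_powers)
  have w_nz: "w ^ \<delta> \<noteq> 0" using root_nonzero[of x w] w \<delta> by (cases "\<delta> = 0") auto
  have e1: "poly L w * poly E1 w = w ^ \<delta> * (poly B w)\<^sup>2"
    using arg_cong[OF E1, of "\<lambda>p. poly p w"] by (simp add: poly_monom)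
  have e2: "poly L w * poly E2 w = (poly A w)\<^sup>2"
    using arg_cong[OF E2, of "\<lambda>p. poly p w"] by simp
  have A: "poly A w \<noteq> 0"
  proof
    assume A0: "poly A w = 0"
    have "poly (Q u) w * poly E2 w = 0"
    proof (cases "poly L w = 0")
      case True
      then have "w ^ \<delta> * (poly B w)\<^sup>2 = 0" using e1 by simp
      then have "poly B w = 0" using w_nz by (metis mult_eq_0_iff power_eq_0_iff)
      then show ?thesis by (simp add: Qw)
    next
      case False
      then show ?thesis using e2 A0 by simp
    qed
    then have "poly (critical_poly u) w = 0" by (auto simp: critical_poly_def Pw A0)
    then show False using gen[of w] A0 by simp
  qed
  have B: "poly B w \<noteq> 0"
  proof
    assume B0: "poly B w = 0"
    have "poly E1 w = 0" using e1 L_nonzero_at[OF A] B0 by simp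
    then have "poly (critical_poly u) w = 0" by (simp add: critical_poly_def Qw B0)
    then show False using gen[of w] B0 by simp
  qed
  have "poly (KP u) w = 2 * poly A w * poly (pderiv (P x)) w"
  proof -
    have "poly (pderiv (P u)) w = poly (pderiv (P x)) w + \<alpha> * poly (pderiv (even_part n (even_powers w))) w"
      by (simp add: Pu pderiv_add pderiv_smult)
    then show ?thesis
      by (simp add: quotient_numerator_def Pw pderiv_even_powers[symmetric] algebra_simps)
  qed
  moreover have "poly (KQ u) w = 2 * poly B w * poly (pderiv (Q x)) w"
  proof -
    have "poly (pderiv (Q u)) w = poly (pderiv (Q x)) w + \<beta> * poly (pderiv (odd_part n (odd_powers w))) w"
      by (simp add: Qu pderiv_add pderiv_smult)
    then show ?thesis
      by (simp add: quotient_numerator_def Qw pderiv_odd_powers[symmetric] algebra_simps)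
  qed
  ultimately have "poly (L * critical_poly u) w = 2 * (poly A w)\<^sup>2 * (poly B w)\<^sup>2 *
      (\<alpha> * poly (pderiv (P x)) w + \<beta> * poly (pderiv (Q x)) w)"
    unfolding critical_poly_eq by (simp add: Pw Qw algebra_simps power2_eq_square)
  then have "poly (critical_poly u) w = 0" using crit L_nonzero_at[OF A] by simp
  moreover have "x = candidate u w"
  proof
    fix i
    show "x i = candidate u w i"
      using fun_cong[OF ux, of i] A B by (simp add: candidate_def Pw Qw)
  qed
  ultimately show ?thesis by blast
qed

text \<open>If this form does not vanish at \<open>u\<close>, then no critical point has a common root at infinity.\<close>
definition top_form :: "(nat \<Rightarrow> complex) \<Rightarrow> complex" where
  "top_form u = u (2 * a) * hat u (2 * a - 2) + u (2 * b + 1) * u (2 * b - 1)"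

theorem critical_points_eq:
  assumes u: "u \<in> affine_space I" and top: "top_form u \<noteq> 0"
    and gen: "\<And>z. poly (critical_poly u) z = 0 \<Longrightarrow> poly A z \<noteq> 0 \<and> poly B z \<noteq> 0 \<and> nondegenerate u z"
  shows "critical_points I X u = candidate u ` {w. poly (critical_poly u) w = 0}"
    and "inj_on (candidate u) {w. poly (critical_poly u) w = 0}"
proof -
  show "critical_points I X u = candidate u ` {w. poly (critical_poly u) w = 0}"
  proof (intro equalityI subsetI)
    fix x assume x: "x \<in> critical_points I X u"
    then have "\<Gamma> x = 0" by (simp add: critical_points_def hypersurface_def)
    then consider w where "common_root (P x) (Q x) w" | "x (2 * a) = 0" "x (2 * b + 1) = 0"
      unfolding Gamma_eq_0_iff by blast
    then show "x \<in> candidate u ` {w. poly (critical_poly u) w = 0}"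
    proof cases
      case 1
      have "\<not> common_root (critical_poly u) (A * B) z" for z using gen[of z] by auto
      from critical_is_candidate[OF u x 1 this] show ?thesis by blast
    next
      case 2
      then show ?thesis using critical_point_infinity[OF u x] top by (simp add: top_form_def)
    qed
  next
    fix x assume "x \<in> candidate u ` {w. poly (critical_poly u) w = 0}"
    then show "x \<in> critical_points I X u" using candidate_critical[OF u] gen by blast
  qed
  show "inj_on (candidate u) {w. poly (critical_poly u) w = 0}"
  proof (rule inj_onI, rule ccontr)
    fix w z
    assume w: "w \<in> {w. poly (critical_poly u) w = 0}" and z: "z \<in> {w. poly (critical_poly u) w = 0}"
      and eq: "candidate u w = candidate u z" and ne: "w \<noteq> z"
    have gw: "poly A w \<noteq> 0" "poly B w \<noteq> 0" "nondegenerate u w" using gen[of w] w by auto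
    have gz: "poly A z \<noteq> 0" "poly B z \<noteq> 0" using gen[of z] z by auto
    have "poly (P (candidate u w)) z = 0" "poly (Q (candidate u w)) z = 0"
      unfolding eq candidate_parts[OF gz] by simp_all
    then have "common_root (even_cofactor u w) (odd_cofactor u w) z"
      unfolding candidate_parts[OF gw(1,2)] using gw(1,2) ne by simp
    then show False using nondegenerate_cofactors(1)[OF gw(3)] by blast
  qed
qed

end

section \<open>Generic data points\<close>

lemma quotient_numerator_smult:
  "quotient_numerator (Polynomial.smult s F) G = Polynomial.smult s (quotient_numerator F G)"
  by (simp add: quotient_numerator_def pderiv_smult smult_diff_right mult.commute)

context hurwitz_distance
begin

lemma poly_family_P: "poly_family I P"
  unfolding poly_family_def
proof (intro conjI allI exI)
  fix k
  show "(\<lambda>u. coeff (P u) k) \<in> polyfuns I"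
    unfolding coeff_even_part hat_def
    by (intro polyfuns_if polyfuns.const polyfuns.coord) auto
qed (rule degree_even_part)

lemma poly_family_Q: "poly_family I Q"
  unfolding poly_family_def
proof (intro conjI allI exI)
  fix k
  show "(\<lambda>u. coeff (Q u) k) \<in> polyfuns I"
    unfolding coeff_odd_part using n \<delta>
    by (intro polyfuns_if polyfuns.const polyfuns.coord) auto
qed (rule degree_odd_part)

lemma poly_family_smult: "f \<in> polyfuns J \<Longrightarrow> poly_family J (\<lambda>u. Polynomial.smult (f u) p)"
  using poly_family_mult[OF poly_family_monom[of f J 0] poly_family_const[of J p]]
  by (simp add: monom_0)

lemma poly_family_critical_poly: "poly_family I critical_poly"
proof -
  have smult: "poly_family I (\<lambda>u. Polynomial.smult c (F u))" if "poly_family I F" for c F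
    using poly_family_mult[OF poly_family_const[of I "[:c:]"] that] by simp
  show ?thesis
    unfolding critical_poly_def KPr_def quotient_numerator_def
    by (intro poly_family_add poly_family_mult poly_family_diff poly_family_pderiv smult poly_family_const
        poly_family_P poly_family_Q)
qed

lemma nondegenerate_family:
  "\<exists>R. poly_family I R \<and> (\<forall>u w. poly (R u) w \<noteq> 0 \<longleftrightarrow> nondegenerate u w)"
proof -
  have "poly_family2 I even_residue"
    unfolding poly_family2_def
  proof
    fix j
    have "poly_family I (\<lambda>u. Polynomial.smult (coeff (P u) j) A -
        P u * (if \<delta> \<le> j \<and> j \<le> a then monom 1 j else 0))"
      using poly_family_P unfolding poly_family_def[of I P]
      by (intro poly_family_diff poly_family_smult poly_family_mult poly_family_P poly_family_const) auto
    then show "\<exists>F. poly_family I F \<and> (\<forall>u w. poly (F u) w = coeff (even_residue u w) j)"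
      by (intro exI conjI) (auto simp: even_residue_def coeff_even_powers poly_monom)
  qed
  then have "poly_family2 I even_cofactor"
    using poly_family2_synthetic_div[of I even_residue a] degree_even_residue
    unfolding even_cofactor_def[abs_def] by blast
  then have E: "poly_family2 I (\<lambda>u w. [:1, 1:] * even_cofactor u w)"
    by (rule poly_family2_linear_factor)
  have "poly_family2 I odd_residue"
    unfolding poly_family2_def
  proof
    fix j
    have "poly_family I (\<lambda>u. Polynomial.smult (coeff (Q u) j) B -
        Q u * (if j \<le> b then monom 1 j else 0))"
      using poly_family_Q unfolding poly_family_def[of I Q]
      by (intro poly_family_diff poly_family_smult poly_family_mult poly_family_Q poly_family_const) auto
    then show "\<exists>F. poly_family I F \<and> (\<forall>u w. poly (F u) w = coeff (odd_residue u w) j)"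
      by (intro exI conjI) (auto simp: odd_residue_def coeff_odd_powers poly_monom)
  qed
  then have O: "poly_family2 I odd_cofactor"
    using poly_family2_synthetic_div[of I odd_residue b] degree_odd_residue
    unfolding odd_cofactor_def[abs_def] by blast
  show ?thesis
    using poly_family2_resultant[OF E O, of a] unfolding nondegenerate_def by metis
qed

lemma E_nonzero: "E1 \<noteq> 0" "E2 \<noteq> 0" "L \<noteq> 0"
  using E1 E2 A_nonzero B_nonzero by auto

lemma degree_E: "degree L + degree E1 = \<delta> + 4 * b" "degree L + degree E2 = 4 * a"
proof -
  show "degree L + degree E1 = \<delta> + 4 * b"
    using arg_cong[OF E1, of degree] E_nonzero B_nonzero degree_B
    by (simp add: degree_mult_eq degree_monom_eq degree_power_eq)
  show "degree L + degree E2 = 4 * a"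
    using arg_cong[OF E2, of degree] E_nonzero A_nonzero degree_A
    by (simp add: degree_mult_eq degree_power_eq)
qed

lemma degree_KPr: "degree (KPr u) \<le> 3 * a - 2 - \<delta>"
proof (rule degree_le, intro allI impI)
  fix i assume i: "3 * a - 2 - \<delta> < i"
  have "degree (KP u) \<le> 3 * a - 2"
    by (rule degree_quotient_numerator[OF degree_even_part _ ab(1)]) (simp add: degree_A)
  then have "coeff (KP u) (i + \<delta>) = 0" using i by (intro coeff_eq_0) linarith
  then show "coeff (KPr u) i = 0" by (simp add: KPr[symmetric] coeff_monom_mult)
qed

lemma degree_first_summand: "degree (P u * KPr u * E1) \<le> ed_degree"
proof -
  have "degree (P u * KPr u * E1) \<le> degree (P u) + degree (KPr u) + degree E1"
    by (meson add_right_mono degree_mult_le order_trans)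
  then show ?thesis
    using degree_KPr[of u] degree_even_part[of n "hat u"] ab(1) \<delta> unfolding ed_degree_def by linarith
qed

lemma degree_second_summand:
  assumes "degree F \<le> b"
  shows "degree (F * quotient_numerator F B * E2) \<le> ed_degree"
proof -
  have "degree (quotient_numerator F B) \<le> 3 * b - 2"
    by (rule degree_quotient_numerator[OF assms _ ab(2)]) (simp add: degree_B)
  moreover have "degree (F * quotient_numerator F B * E2) \<le>
      degree F + degree (quotient_numerator F B) + degree E2"
    by (meson add_right_mono degree_mult_le order_trans)
  ultimately show ?thesis
    using assms ab(1,2) \<delta> degree_E unfolding ed_degree_def by linarith
qed

lemma degree_critical_poly: "degree (critical_poly u) \<le> ed_degree"
  unfolding critical_poly_def
  by (intro degree_add_le degree_first_summand degree_second_summand degree_odd_part)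

lemma ed_degree_pos: "ed_degree \<ge> 1"
  using ab(1) \<delta> unfolding ed_degree_def by linarith

text \<open>A point \<open>u\<close> at which the generic behaviour can be verified: \<open>P u = (1 + t) ^ a\<close> and
  \<open>Q u = s * (\<kappa> + t)\<close>.  The critical polynomial is then a pencil with parameter \<open>s\<^sup>2\<close>.\<close>
definition special :: "complex \<Rightarrow> complex \<Rightarrow> nat \<Rightarrow> complex" where
  "special s \<kappa> i = (if i \<in> I then
     (if even i then coeff ([:1, 1:] ^ a) (i div 2) else s * coeff [:\<kappa>, 1:] (i div 2)) else 0)"

lemma special_affine: "special s \<kappa> \<in> affine_space I"
  by (simp add: affine_space_def special_def)

lemma P_special: "P (special s \<kappa>) = [:1, 1:] ^ a"
proof (rule poly_eqI)
  fix k
  show "coeff (P (special s \<kappa>)) k = coeff ([:1, 1:] ^ a) k"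
  proof (cases "k \<le> a")
    case True
    then have "2 * k \<le> n" by simp
    moreover have "k = 0" if "2 * k < \<delta>" using that \<delta> by simp
    moreover have "coeff ([:1, 1:] ^ a) 0 = (1 :: complex)" by (simp add: coeff_0_power)
    ultimately show ?thesis using True by (auto simp: coeff_even_part hat_def special_def)
  next
    case False
    then have "coeff ([:1, 1:] ^ a :: complex poly) k = 0"
      by (intro coeff_eq_0) (simp add: degree_power_eq)
    then show ?thesis using False by (simp add: coeff_even_part)
  qed
qed

lemma Q_special: "Q (special s \<kappa>) = Polynomial.smult s [:\<kappa>, 1:]"
proof (rule poly_eqI)
  fix k
  show "coeff (Q (special s \<kappa>)) k = coeff (Polynomial.smult s [:\<kappa>, 1:]) k"
  proof (cases "k \<le> b")
    case True
    then have "2 * k + 1 \<le> n" using ab(7) by linarith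
    moreover have "\<delta> \<le> 2 * k + 1" using \<delta> by simp
    ultimately show ?thesis using True by (simp add: coeff_odd_part special_def del: smult_pCons)
  next
    case False
    then have "k > 1" using ab(2) by linarith
    then have "coeff (Polynomial.smult s [:\<kappa>, 1:]) k = 0" by (simp add: coeff_pCons split: nat.splits)
    then show ?thesis using False by (simp add: coeff_odd_part)
  qed
qed

definition pencil0 :: "complex poly" where
  "pencil0 = P (special 0 0) * KPr (special 0 0) * E1"

definition pencil1 :: "complex \<Rightarrow> complex poly" where
  "pencil1 \<kappa> = [:\<kappa>, 1:] * quotient_numerator [:\<kappa>, 1:] B * E2"

lemma critical_poly_special:
  "critical_poly (special s \<kappa>) = pencil0 + Polynomial.smult (s\<^sup>2) (pencil1 \<kappa>)"
proof -
  have "Polynomial.smult s X * Polynomial.smult s K * E2 = Polynomial.smult (s\<^sup>2) (X * K * E2)" for X K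
    by (simp add: power2_eq_square)
  then show ?thesis
    unfolding critical_poly_def pencil0_def pencil1_def KPr_def P_special Q_special
      quotient_numerator_smult by (simp only:)
qed

lemma A_minus_one: "poly A (-1) \<noteq> 0"
  using poly_even_geometric_special(2) by (simp add: A_def poly_monom)

lemma coeff_A: "coeff A (2 * a) = 1" "coeff A (2 * a - 1) = 0"
proof -
  have "2 * k = 2 * a \<longleftrightarrow> k = a" for k by simp
  then have "coeff A (2 * a) = (\<Sum>k\<in>{\<delta>..a}. if k = a then 1 else 0)"
    unfolding A_alt coeff_sum coeff_monom by (simp only:)
  moreover have "\<delta> \<le> a" using \<delta> ab(1) by linarith
  ultimately show "coeff A (2 * a) = 1" by simp
  have "2 * k \<noteq> 2 * a - 1" for k using ab(1) by presburger
  then show "coeff A (2 * a - 1) = 0" unfolding A_alt coeff_sum coeff_monom by (simp only: if_False sum.neutral_const)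
qed

lemma pencil0_top: "coeff pencil0 ed_degree \<noteq> 0"
proof -
  obtain c where c: "a = Suc c" using ab(1) by (cases a) auto
  define W where "W = Polynomial.smult (2 * of_nat a) A - [:1, 1:] * pderiv A"
  have KP: "KP (special 0 0) = [:1, 1:] ^ c * W"
  proof -
    have "pderiv ([:1, 1:] ^ Suc c) = Polynomial.smult (of_nat a) ([:1, 1 :: complex:] ^ c)"
      unfolding pderiv_power_Suc c by (simp add: pderiv_pCons)
    moreover have "Polynomial.smult 2 (Polynomial.smult m Z * A) - (Y * Z) * pderiv A =
        Z * (Polynomial.smult (2 * m) A - Y * pderiv A)" for m Y Z
      by (simp add: algebra_simps)
    ultimately show ?thesis
      unfolding quotient_numerator_def P_special W_def by (simp only: c power_Suc)
  qed
  have A_top: "coeff A (2 * c + 2) = 1" "coeff A (2 * c + 1) = 0" using coeff_A by (simp_all add: c)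
  have A_above: "coeff A i = 0" if "i > 2 * c + 2" for i
    using that degree_A by (intro coeff_eq_0) (simp add: c)
  have coeff_W: "coeff W (Suc j) = 2 * of_nat a * coeff A (j + 1) -
      (of_nat (j + 2) * coeff A (j + 2) + of_nat (j + 1) * coeff A (j + 1))" for j
    by (simp add: W_def coeff_pderiv)
  have dW: "degree W \<le> 2 * a - 1"
  proof (rule degree_le, intro allI impI)
    fix i assume i: "2 * a - 1 < i"
    then obtain j where j: "i = Suc j" by (cases i) auto
    then have "j = 2 * c + 1 \<or> j > 2 * c + 1" using i c by auto
    then show "coeff W i = 0"
      using A_top A_above by (auto simp: j coeff_W c)
  qed
  have idx: "2 * a - 1 = Suc (2 * c)" by (simp add: c)
  have W: "coeff W (2 * a - 1) = - (2 * of_nat a)"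
    unfolding idx coeff_W A_top by (simp add: c)
  have pow: "degree ([:1, 1:] ^ k :: complex poly) \<le> k" "coeff ([:1, 1:] ^ k :: complex poly) k = 1" for k
    using coeff_linear_power[of "1::complex" k] by (simp_all add: degree_power_eq)
  have "coeff (KP (special 0 0)) (c + (2 * a - 1)) = - (2 * of_nat a)"
    unfolding KP coeff_mult_at_bounds[OF pow(1) dW] pow W by simp
  moreover have "c + (2 * a - 1) = (3 * a - 2 - \<delta>) + \<delta>" using c \<delta> by simp
  moreover have "coeff (KP u) (i + \<delta>) = coeff (KPr u) i" for u i
    by (simp add: KPr[symmetric] coeff_monom_mult)
  ultimately have K: "coeff (KPr (special 0 0)) (3 * a - 2 - \<delta>) = - (2 * of_nat a)" by metis
  have 1: "coeff (P (special 0 0) * KPr (special 0 0)) (a + (3 * a - 2 - \<delta>)) \<noteq> 0"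
    unfolding P_special coeff_mult_at_bounds[OF pow(1) degree_KPr] pow K using ab(1) by simp
  have "degree (P (special 0 0) * KPr (special 0 0)) \<le> a + (3 * a - 2 - \<delta>)"
    using degree_mult_le[of "P (special 0 0)"] degree_KPr[of "special 0 0"] degree_even_part[of n]
    by (meson add_mono order_trans)
  from coeff_mult_at_bounds[OF this order_refl, of E1]
  have "coeff pencil0 (a + (3 * a - 2 - \<delta>) + degree E1) \<noteq> 0"
    using 1 E_nonzero(1) unfolding pencil0_def by simp
  moreover have "a + (3 * a - 2 - \<delta>) + degree E1 = ed_degree"
    using ab(1) \<delta> unfolding ed_degree_def by linarith
  ultimately show ?thesis by simp
qed

text \<open>The roots of \<open>pencil0\<close> are \<open>-1\<close>, roots of \<open>KPr\<close> and roots of \<open>E1\<close>.  As \<open>A\<close> has no multiple root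
  other than \<open>0\<close>, none of them is a root of \<open>E2\<close>.\<close>
lemma pencil0_root_E2:
  assumes "poly pencil0 z = 0"
  shows "poly E2 z \<noteq> 0"
proof
  assume E2z: "poly E2 z = 0"
  then have A: "poly A z = 0" using arg_cong[OF E2, of "\<lambda>p. poly p z"] by simp
  have "z \<noteq> -1" using A A_minus_one by auto
  then have "1 + z \<noteq> 0" by (metis add.commute eq_neg_iff_add_eq_0)
  then have Pz: "poly (P (special 0 0)) z \<noteq> 0" unfolding P_special by simp
  then have K: "poly (KPr (special 0 0)) z = 0"
    using assms E_coprime[of z] E2z by (auto simp: pencil0_def)
  then have "poly (KP (special 0 0)) z = 0" by (simp add: KPr[symmetric])
  then have "poly (pderiv A) z = 0" using A Pz by (simp add: quotient_numerator_def)
  then have z: "\<delta> = 1" "z = 0" using A_root A by auto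
  have "poly (KPr u) 0 = - 2 * of_nat \<delta> * poly (P u) 0 * poly (even_geometric (a - \<delta>)) 0"
    if "\<delta> \<noteq> 0" for u
    using that by (simp add: KPr_def poly_monom power_0_left)
  from this[of "special 0 0"] show False
    using K z Pz poly_even_geometric_special(1)[of "a - \<delta>"] by (metis mult_eq_0_iff neg_equal_0_iff_equal
        of_nat_eq_0_iff one_neq_zero zero_neq_numeral)
qed

text \<open>At each of the finitely many roots \<open>z\<close> of \<open>pencil0\<close>, the value of \<open>pencil1 \<kappa>\<close> is a nonzero
  polynomial in \<open>\<kappa>\<close>, because \<open>E2\<close> does not vanish at \<open>z\<close> and \<open>B\<close> has no multiple root.\<close>
lemma good_kappa: obtains \<kappa> where "\<forall>z. \<not> common_root pencil0 (pencil1 \<kappa>) z"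
proof -
  have "pencil0 \<noteq> 0" using pencil0_top by auto
  then have fin: "finite {z. poly pencil0 z = 0}" by (rule poly_roots_finite)
  have "finite {\<kappa>. poly (pencil1 \<kappa>) z = 0}" if z: "poly pencil0 z = 0" for z
  proof -
    let ?B = "poly B z" and ?B' = "poly (pderiv B) z"
    have "poly (pencil1 \<kappa>) z = (z + \<kappa> * 1) * ((2 * ?B - z * ?B') + \<kappa> * (- ?B')) * poly E2 z" for \<kappa>
      by (simp add: pencil1_def quotient_numerator_def pderiv_pCons algebra_simps)
    then have "{\<kappa>. poly (pencil1 \<kappa>) z = 0} =
        {\<kappa>. z + \<kappa> * 1 = 0} \<union> {\<kappa>. (2 * ?B - z * ?B') + \<kappa> * (- ?B') = 0}"
      using pencil0_root_E2[OF z] by auto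
    moreover have "2 * ?B - z * ?B' \<noteq> 0 \<or> - ?B' \<noteq> 0"
      using even_geometric_squarefree[of b z] by (auto simp: B_def)
    ultimately show ?thesis
      using finite_affine_roots[of z 1] finite_affine_roots[of "2 * ?B - z * ?B'" "- ?B'"] by simp
  qed
  then have "finite (\<Union>z\<in>{z. poly pencil0 z = 0}. {\<kappa>. poly (pencil1 \<kappa>) z = 0})" using fin by blast
  from ex_new_if_finite[OF infinite_UNIV_char_0 this] show thesis using that by blast
qed

lemma cofactors_special:
  shows "even_cofactor (special s \<kappa>) w = even_cofactor (special 1 \<kappa>) w"
    and "odd_cofactor (special s \<kappa>) w = Polynomial.smult s (odd_cofactor (special 1 \<kappa>) w)"
proof -
  show "even_cofactor (special s \<kappa>) w = even_cofactor (special 1 \<kappa>) w"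
    by (simp add: even_cofactor_def even_residue_def P_special)
  have "odd_residue (special s \<kappa>) w = Polynomial.smult s (odd_residue (special 1 \<kappa>) w)"
  proof -
    have "Polynomial.smult c (Polynomial.smult s q) - Polynomial.smult (poly (Polynomial.smult s q) w) r =
        Polynomial.smult s (Polynomial.smult c q - Polynomial.smult (poly q w) r)" for c q r
      by (simp add: smult_diff_right mult.commute)
    from this[of _ "[:\<kappa>, 1:]"] show ?thesis
      unfolding odd_residue_def Q_special by (simp only: smult_1_left)
  qed
  then have "[:-w, 1:] * odd_cofactor (special s \<kappa>) w =
      [:-w, 1:] * Polynomial.smult s (odd_cofactor (special 1 \<kappa>) w)"
    by (simp only: odd_residue_factor mult_smult_right)
  then show "odd_cofactor (special s \<kappa>) w = Polynomial.smult s (odd_cofactor (special 1 \<kappa>) w)"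
    unfolding mult_cancel_left by simp
qed

lemma nondegenerate_special:
  "s \<noteq> 0 \<Longrightarrow> nondegenerate (special s \<kappa>) w \<longleftrightarrow> nondegenerate (special 1 \<kappa>) w"
  unfolding nondegenerate_iff cofactors_special[of s \<kappa> w] by simp

text \<open>At \<open>w = -1\<close> the even cofactor is a multiple of \<open>(1 + t) ^ (a - 1)\<close>.\<close>
lemma nondegenerate_minus_one:
  assumes "\<And>z. \<not> common_root pencil0 (pencil1 \<kappa>) z"
  shows "nondegenerate (special 1 \<kappa>) (-1)"
proof -
  let ?u = "special 1 \<kappa>"
  obtain c where c: "a = Suc c" using ab(1) by (cases a) auto
  have "even_residue ?u (-1) = [:1, 1:] * Polynomial.smult (poly A (-1)) ([:1, 1:] ^ c)"
    unfolding even_residue_def P_special c by (simp add: mult_smult_right del: mult_pCons_left)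
  then have "[:1, 1:] * even_cofactor ?u (-1) = [:1, 1:] * Polynomial.smult (poly A (-1)) ([:1, 1:] ^ c)"
    using even_residue_factor[of ?u "-1"] by simp
  then have ec: "even_cofactor ?u (-1) = Polynomial.smult (poly A (-1)) ([:1, 1:] ^ c)"
    unfolding mult_cancel_left by simp
  have "poly pencil0 (-1) = 0" by (simp add: pencil0_def P_special c)
  then have "poly (pencil1 \<kappa>) (-1) \<noteq> 0" using assms by blast
  then have "poly (KQ ?u) (-1) \<noteq> 0" by (simp add: pencil1_def Q_special)
  then have oc: "poly (odd_cofactor ?u (-1)) (-1) \<noteq> 0" by (simp flip: odd_cofactor_at)
  have "z = -1" if "poly ([:1, 1:] * even_cofactor ?u (-1)) z = 0" for z
  proof -
    have "poly ([:1, 1:] * Polynomial.smult \<alpha> ([:1, 1:] ^ c)) z = \<alpha> * (1 + z) ^ Suc c" for \<alpha> :: complex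
      by (simp add: algebra_simps)
    then have "poly A (-1) * (1 + z) ^ Suc c = 0" using that unfolding ec by metis
    then have "1 + z = 0" using A_minus_one by (metis mult_eq_0_iff power_eq_0_iff)
    then show "z = -1" by (metis add.commute eq_neg_iff_add_eq_0)
  qed
  moreover have "coeff (even_cofactor ?u (-1)) (a - 1) \<noteq> 0"
    using A_minus_one coeff_linear_power[of "1::complex" c] unfolding ec by (simp add: c)
  ultimately show ?thesis using oc unfolding nondegenerate_iff by blast
qed

lemma top_form_special:
  "top_form (special s \<kappa>) = of_nat a + s\<^sup>2 * (coeff [:\<kappa>, 1:] b * coeff [:\<kappa>, 1:] (b - 1))"
proof -
  let ?u = "special s \<kappa>"
  have "2 * (a - 1) = 2 * a - 2" by simp
  then have P: "hat ?u (2 * a) = coeff (P ?u) a" "hat ?u (2 * a - 2) = coeff (P ?u) (a - 1)"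
    by (simp_all add: coeff_even_part)
  have "2 * (k - 1) + 1 = 2 * k - 1" if "k \<ge> 1" for k :: nat using that by simp
  from this[OF ab(2)] have Q: "?u (2 * b + 1) = coeff (Q ?u) b" "?u (2 * b - 1) = coeff (Q ?u) (b - 1)"
    by (simp_all only: coeff_odd_part if_True order_refl diff_le_self)
  have "\<not> 2 * a < \<delta>" using ab(1) \<delta> by linarith
  then have "?u (2 * a) = coeff (P ?u) a" using P(1) by (simp add: hat_def)
  moreover have "coeff ([:1, 1:] ^ a) (a - 1) = (of_nat a :: complex)"
  proof -
    have "coeff ([:1, 1:] ^ Suc m) m = (of_nat (Suc m) :: complex)" for m
      by (subst coeff_linear_poly_power) (simp_all add: binomial_symmetric[of m "Suc m"])
    from this[of "a - 1"] show ?thesis using ab(1) by simp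
  qed
  moreover have "coeff ([:1, 1:] ^ a) a = (1 :: complex)"
    using coeff_linear_power[of "1::complex" a] by simp
  ultimately show ?thesis
    unfolding top_form_def P(2) Q P_special Q_special by (simp add: power2_eq_square del: smult_pCons)
qed

text \<open>Each requirement excludes only finitely many values of the pencil parameter \<open>t = s\<^sup>2\<close>: the cofactors
  change with \<open>s\<close> only by a nonzero factor, so the degenerate \<open>w\<close> form a finite set that
  does not depend on \<open>s\<close>.\<close>
lemma generic_point:
  assumes R: "\<And>u w. poly (R u) w \<noteq> 0 \<longleftrightarrow> nondegenerate u w"
  obtains u where "u \<in> affine_space I" "coeff (critical_poly u) ed_degree \<noteq> 0" "top_form u \<noteq> 0"
    "pderiv (critical_poly u) * (A * B * R u) \<noteq> 0"
    "\<And>z. \<not> common_root (critical_poly u) (pderiv (critical_poly u) * (A * B * R u)) z"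
proof -
  obtain \<kappa> where "\<forall>z. \<not> common_root pencil0 (pencil1 \<kappa>) z" by (rule good_kappa)
  then have \<kappa>: "\<not> common_root pencil0 (pencil1 \<kappa>) z" for z by blast
  let ?c = "coeff [:\<kappa>, 1:] b * coeff [:\<kappa>, 1:] (b - 1)"
  have R1: "R (special s \<kappa>) \<noteq> 0" if "s \<noteq> 0" for s
    using nondegenerate_minus_one[OF \<kappa>] nondegenerate_special[OF that] R by (metis poly_0)
  define Z where "Z = {z. poly (A * B * R (special 1 \<kappa>)) z = 0}"
  have "A * B * R (special 1 \<kappa>) \<noteq> 0" using R1[of 1] A_nonzero B_nonzero by simp
  then have Z: "finite Z" unfolding Z_def by (rule poly_roots_finite)
  have "degree pencil0 > 0" using le_degree[OF pencil0_top] ed_degree_pos by linarith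
  define S1 where "S1 = {t. \<exists>w. common_root (pencil0 + Polynomial.smult t (pencil1 \<kappa>))
    (pderiv (pencil0 + Polynomial.smult t (pencil1 \<kappa>))) w}"
  define S2 where "S2 = {t. \<exists>z\<in>Z. poly (pencil0 + Polynomial.smult t (pencil1 \<kappa>)) z = 0}"
  define S3 where "S3 = {t. coeff pencil0 ed_degree + t * coeff (pencil1 \<kappa>) ed_degree = 0}"
  define S4 where "S4 = {t. of_nat a + t * ?c = 0}"
  have "finite S1" unfolding S1_def by (rule pencil_squarefree[OF \<kappa> \<open>degree pencil0 > 0\<close>])
  moreover have "finite S2" unfolding S2_def by (rule pencil_avoids[OF \<kappa> Z])
  moreover have "finite S3" unfolding S3_def by (rule finite_affine_roots) (simp add: pencil0_top)
  moreover have "finite S4" unfolding S4_def by (rule finite_affine_roots) (use ab(1) in simp)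
  ultimately have "finite (S1 \<union> S2 \<union> S3 \<union> S4 \<union> {0})" by simp
  from ex_new_if_finite[OF infinite_UNIV_char_0 this] obtain t where
    "t \<notin> S1" "t \<notin> S2" "t \<notin> S3" "t \<notin> S4" "t \<noteq> 0" by blast
  then have t: "\<not> common_root (pencil0 + Polynomial.smult t (pencil1 \<kappa>))
        (pderiv (pencil0 + Polynomial.smult t (pencil1 \<kappa>))) w"
      "z \<in> Z \<Longrightarrow> poly (pencil0 + Polynomial.smult t (pencil1 \<kappa>)) z \<noteq> 0"
      "coeff pencil0 ed_degree + t * coeff (pencil1 \<kappa>) ed_degree \<noteq> 0"
      "of_nat a + t * ?c \<noteq> 0" "t \<noteq> 0" for w z
    unfolding S1_def S2_def S3_def S4_def by blast+
  define s where "s = csqrt t"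
  have s: "s\<^sup>2 = t" "s \<noteq> 0" using t(5) by (auto simp: s_def)
  let ?u = "special s \<kappa>"
  have N: "critical_poly ?u = pencil0 + Polynomial.smult t (pencil1 \<kappa>)"
    using critical_poly_special[of s \<kappa>] s by simp
  have top: "coeff (critical_poly ?u) ed_degree \<noteq> 0" using t(3) by (simp add: N)
  have "degree (critical_poly ?u) > 0" using le_degree[OF top] ed_degree_pos by linarith
  then have "pderiv (critical_poly ?u) \<noteq> 0" by (simp add: pderiv_eq_0_iff)
  then have nz: "pderiv (critical_poly ?u) * (A * B * R ?u) \<noteq> 0"
    using A_nonzero B_nonzero R1[OF s(2)] by simp
  have "poly (A * B * R ?u) z = 0 \<longleftrightarrow> z \<in> Z" for z
    using R[of ?u z] R[of "special 1 \<kappa>" z] nondegenerate_special[OF s(2), of \<kappa> z]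
    by (auto simp: Z_def)
  then have "\<not> common_root (critical_poly ?u) (pderiv (critical_poly ?u) * (A * B * R ?u)) z" for z
    using t(1,2) unfolding N poly_mult[of "pderiv (pencil0 + Polynomial.smult t (pencil1 \<kappa>))"] mult_eq_0_iff
    by blast
  then show thesis
    using that[OF special_affine top _ nz] t(4) unfolding top_form_special s(1) by blast
qed

theorem has_EDdegree_hurwitz: "has_EDdegree I X ed_degree"
proof -
  obtain R where R: "poly_family I R" "\<And>u w. poly (R u) w \<noteq> 0 \<longleftrightarrow> nondegenerate u w"
    using nondegenerate_family by blast
  let ?N = critical_poly
  let ?G = "\<lambda>u. pderiv (?N u) * (A * B * R u)"
  obtain u0 where u0: "u0 \<in> affine_space I" "coeff (?N u0) ed_degree \<noteq> 0" "top_form u0 \<noteq> 0"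
    "?G u0 \<noteq> 0" "\<And>z. \<not> common_root (?N u0) (?G u0) z"
    by (rule generic_point[of R]) (use R(2) in auto)
  have G: "poly_family I ?G"
    by (intro poly_family_mult poly_family_pderiv poly_family_const poly_family_critical_poly R(1))
  obtain g where g: "g \<in> polyfuns I" "g u0 \<noteq> 0" "\<And>u z. g u \<noteq> 0 \<Longrightarrow> \<not> common_root (?N u) (?G u) z"
    using generic_no_common_root[OF poly_family_critical_poly degree_critical_poly G u0(2,4,5)] by blast
  have top: "top_form \<in> polyfuns I"
  proof -
    have "(\<lambda>u. u (2 * a) * hat u (2 * a - 2) + u (2 * b + 1) * u (2 * b - 1)) \<in> polyfuns I"
      unfolding hat_def
    proof (intro polyfuns.add polyfuns.mult polyfuns_if polyfuns.const polyfuns.coord)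
      show "2 * a \<in> I" "2 * b + 1 \<in> I" "2 * b - 1 \<in> I"
        unfolding atLeastAtMost_iff using ab(1,2,6,7) \<delta> by linarith+
      assume "\<not> 2 * a - 2 < \<delta>"
      then show "2 * a - 2 \<in> I" unfolding atLeastAtMost_iff using ab(6) by linarith
    qed
    then show ?thesis by (simp add: top_form_def[abs_def])
  qed
  define f where "f = (\<lambda>u. g u * coeff (?N u) ed_degree * top_form u)"
  have f: "f \<in> polyfuns I"
    unfolding f_def using poly_family_critical_poly
    by (intro polyfuns.mult g(1) top) (simp add: poly_family_def)
  define U where "U = {u \<in> affine_space I. f u \<noteq> 0}"
  have "zariski_open I U" unfolding zariski_open_def U_def by (rule exI[of _ "{f}"]) (use f in auto)
  moreover have "U \<noteq> {}" using u0 g(2) by (auto simp: U_def f_def)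
  moreover have "finite (critical_points I X u) \<and> card (critical_points I X u) = ed_degree" if "u \<in> U" for u
  proof -
    have u: "u \<in> affine_space I" "g u \<noteq> 0" "coeff (?N u) ed_degree \<noteq> 0" "top_form u \<noteq> 0"
      using that by (auto simp: U_def f_def)
    have gen: "poly A z \<noteq> 0 \<and> poly B z \<noteq> 0 \<and> nondegenerate u z" if "poly (?N u) z = 0" for z
      using g(3)[OF u(2), of z] that R(2)[of u z] by auto
    have "?N u \<noteq> 0" using u(3) by auto
    then have "finite {w. poly (?N u) w = 0}" by (rule poly_roots_finite)
    moreover have "card {w. poly (?N u) w = 0} = degree (?N u)"
      using g(3)[OF u(2)] by (intro card_simple_roots \<open>?N u \<noteq> 0\<close>) auto
    moreover have "degree (?N u) = ed_degree"
      using degree_critical_poly[of u] le_degree[OF u(3)] by (rule antisym)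
    ultimately show ?thesis
      using critical_points_eq[OF u(1,4) gen] by (simp add: card_image)
  qed
  ultimately show ?thesis unfolding has_EDdegree_def by blast
qed

end

section \<open>ED degrees of the Hurwitz determinants\<close>

lemma (in hurwitz_hypersurface) hat_cases:
  "\<delta> = 0 \<Longrightarrow> hat x = x" "\<delta> = 1 \<Longrightarrow> hat x = x(0 := 1)"
  unfolding hat_def by auto

lemma monom_square_split: "monom 1 1 * monom 1 3 = (monom 1 (2 * 1) :: complex poly)\<^sup>2"
  by (simp add: mult_monom power2_eq_square)

text \<open>Up to a power of the variable, the common factor \<open>L\<close> is all of \<open>B\<^sup>2\<close> if \<open>A\<close> and \<open>B\<close> are geometric
  sums of the same length, and \<open>1\<close> if the lengths differ by one, since consecutive sums are coprime.\<close>
lemma EDdegree_homogeneous_odd: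
  assumes m: "m \<ge> 1" and nm: "n = 2 * m + 1"
  shows "has_EDdegree {0..n} (hypersurface {0..n} (hurwitz_Gamma_bar n)) (4 * m - 2)"
proof -
  interpret hurwitz_distance n 0 1 1 "(even_geometric m)\<^sup>2"
    "monom 1 (2 * 0) * even_geometric (n div 2 - 0)" "even_geometric ((n - 1) div 2)"
    by unfold_locales (use m nm in auto)
  have "n div 2 = m" using nm by simp
  then have d: "ed_degree = 4 * m - 2" unfolding ed_degree_def by simp
  show ?thesis using has_EDdegree_hurwitz unfolding d hat_cases(1)[OF refl] .
qed

lemma EDdegree_homogeneous_even:
  assumes m: "m \<ge> 2" and nm: "n = 2 * m"
  shows "has_EDdegree {0..n} (hypersurface {0..n} (hurwitz_Gamma_bar n)) (8 * m - 6)"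
proof -
  have idx: "(n - 1) div 2 = m - 1" "n div 2 = m" "m = Suc (m - 1)" using m nm by auto
  interpret hurwitz_distance n 0 "(even_geometric (m - 1))\<^sup>2" "(even_geometric m)\<^sup>2" 1
    "monom 1 (2 * 0) * even_geometric (n div 2 - 0)" "even_geometric ((n - 1) div 2)"
  proof unfold_locales
    fix z show "\<not> common_root ((even_geometric (m - 1))\<^sup>2) ((even_geometric m)\<^sup>2) z"
      using even_geometric_consecutive[of "m - 1" z] idx(3) by simp
  qed (use m nm idx(1,2) in auto)
  have d: "ed_degree = 8 * m - 6"
    unfolding ed_degree_def idx(2)
    using m by (simp add: degree_power_eq even_geometric_nonzero degree_even_geometric)
  show ?thesis using has_EDdegree_hurwitz unfolding d hat_cases(1)[OF refl] .
qed

lemma EDdegree_nonhomogeneous_even: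
  assumes m: "m \<ge> 2" and nm: "n = 2 * m"
  shows "has_EDdegree {1..n} (hypersurface {1..n} (hurwitz_Gamma n)) (4 * m - 3)"
proof -
  have idx: "(n - 1) div 2 = m - 1" "n div 2 = m" "m = Suc (m - 1)" using m nm by auto
  interpret hurwitz_distance n 1 1 "monom 1 3" "monom 1 1 * (even_geometric (m - 1))\<^sup>2"
    "monom 1 (2 * 1) * even_geometric (n div 2 - 1)" "even_geometric ((n - 1) div 2)"
  proof unfold_locales
    show "monom 1 1 * (even_geometric (m - 1))\<^sup>2 * monom 1 3 =
        (monom 1 (2 * 1) * even_geometric (n div 2 - 1))\<^sup>2"
      unfolding idx(1,2) power_mult_distrib monom_square_split[symmetric] by (simp only: mult_ac)
  qed (use m nm idx(1,2) in auto)
  have d: "ed_degree = 4 * m - 3" unfolding ed_degree_def idx(2) using m by simp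
  show ?thesis
    using has_EDdegree_hurwitz unfolding d hat_cases(2)[OF refl] hurwitz_Gamma_def[abs_def] .
qed

lemma EDdegree_nonhomogeneous_odd:
  assumes m: "m \<ge> 1" and nm: "n = 2 * m + 1"
  shows "has_EDdegree {1..n} (hypersurface {1..n} (hurwitz_Gamma n)) (8 * m - 3)"
proof -
  have idx: "(n - 1) div 2 = m" "n div 2 = m" "m = Suc (m - 1)" using m nm by auto
  interpret hurwitz_distance n 1 "(even_geometric m)\<^sup>2" "monom 1 3 * (even_geometric (m - 1))\<^sup>2" "monom 1 1"
    "monom 1 (2 * 1) * even_geometric (n div 2 - 1)" "even_geometric ((n - 1) div 2)"
  proof unfold_locales
    show "monom 1 1 * (monom 1 3 * (even_geometric (m - 1))\<^sup>2) =
        (monom 1 (2 * 1) * even_geometric (n div 2 - 1))\<^sup>2"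
      unfolding idx(1,2) power_mult_distrib monom_square_split[symmetric] by (simp only: mult_ac)
    fix z show "\<not> common_root ((even_geometric m)\<^sup>2) (monom 1 3 * (even_geometric (m - 1))\<^sup>2) z"
      using even_geometric_consecutive[of "m - 1" z] idx(3) poly_even_geometric_special(1)[of m]
      by (auto simp: poly_monom)
  qed (use m nm idx(1,2) in auto)
  have d: "ed_degree = 8 * m - 3"
    unfolding ed_degree_def idx(2)
    using m by (simp add: degree_power_eq even_geometric_nonzero degree_even_geometric)
  show ?thesis
    using has_EDdegree_hurwitz unfolding d hat_cases(2)[OF refl] hurwitz_Gamma_def[abs_def] .
qed

text \<open>For \<open>n = 2\<close> the odd part is the constant \<open>x 1\<close>.  It vanishes identically on the hypersurface, and the
  pencil above has no counterpart; but the hypersurface is a line.\<close>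
lemma EDdegree_nonhomogeneous_two:
  "has_EDdegree {1..2} (hypersurface {1..2} (hurwitz_Gamma 2)) 1"
proof -
  define J where "J = {1..2 :: nat}"
  define X where "X = hypersurface J (hurwitz_Gamma 2)"
  have J: "J = {1, 2}" by (auto simp: J_def)
  have "hurwitz_Gamma 2 x = x 1" for x
    unfolding hurwitz_Gamma_def hurwitz_Gamma_bar_eq_det
    by (subst det_single) (simp_all add: hurwitz_minor_def sylvester_row_def coeff_odd_part)
  then have X: "x \<in> X \<longleftrightarrow> x \<in> affine_space J \<and> x 1 = 0" for x by (simp add: X_def hypersurface_def)
  have crit: "critical_points J X u = {\<lambda>i. if i = 2 then u 2 else 0}" (is "_ = {?x}")
    if u: "u \<in> affine_space J" for u
  proof (intro equalityI subsetI)
    fix x assume x: "x \<in> critical_points J X u"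
    then have x1: "x \<in> affine_space J" "x 1 = 0" by (auto simp: critical_points_def X)
    have "unit_vec_at 2 \<in> tangent_space J X x"
      unfolding tangent_space_def
    proof (intro CollectI conjI ballI affine_space_unit)
      fix f assume f: "f \<in> vanishing_ideal J X"
      have "x(2 := t) \<in> X" for t using x1 by (auto simp: X affine_space_def J)
      then have "f (x(2 := t)) = 0" for t using f by (simp add: vanishing_ideal_def)
      then have "partial_deriv 2 f x = 0" by (simp add: partial_deriv_def)
      then show "(\<Sum>i\<in>J. partial_deriv i f x * unit_vec_at 2 i) = 0"
        by (simp add: J unit_vec_at_def)
    qed (simp add: J)
    then have "bilinear_form J (\<lambda>i. u i - x i) (unit_vec_at 2) = 0"
      using x by (simp add: critical_points_def)
    then have "x 2 = u 2" by (simp add: bilinear_form_def J unit_vec_at_def)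
    then have "x i = ?x i" for i using x1 by (cases "i = 1") (auto simp: affine_space_def J)
    then have "x = ?x" by blast
    then show "x \<in> {?x}" by simp
  next
    fix x assume "x \<in> {?x}"
    then have x: "x = ?x" by simp
    then have xX: "x \<in> X" by (auto simp: X affine_space_def J)
    let ?f = "\<lambda>y :: nat \<Rightarrow> complex. y 1"
    have f: "?f \<in> vanishing_ideal J X"
      by (auto simp: vanishing_ideal_def X J intro: polyfuns.coord)
    have pd: "partial_deriv 1 ?f x = 1" "partial_deriv 2 ?f x = 0" by (simp_all add: partial_deriv_def)
    have "x \<notin> hypersurface_sing J X"
    proof
      assume "x \<in> hypersurface_sing J X"
      then have "\<forall>g \<in> vanishing_ideal J X. \<forall>i\<in>J. partial_deriv i g x = 0"
        unfolding hypersurface_sing_def by blast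
      moreover have "1 \<in> J" by (simp add: J)
      ultimately have "partial_deriv 1 ?f x = 0" using f by (metis (no_types, lifting))
      then show False using pd(1) by simp
    qed
    moreover have "bilinear_form J (\<lambda>i. u i - x i) v = 0" if "v \<in> tangent_space J X x" for v
    proof -
      have "(\<Sum>i\<in>J. partial_deriv i ?f x * v i) = 0" using that f by (simp add: tangent_space_def)
      then have "v 1 = 0" using pd by (simp add: J)
      then show ?thesis by (simp add: bilinear_form_def J x)
    qed
    ultimately show "x \<in> critical_points J X u" using xX by (simp add: critical_points_def)
  qed
  have "zariski_open J (affine_space J)"
    unfolding zariski_open_def by (rule exI[of _ "{\<lambda>x. 1}"]) (auto intro: polyfuns.const)
  moreover have "affine_space J \<noteq> {}" using affine_space_unit[of 1 J] by (auto simp: J)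
  ultimately show ?thesis unfolding has_EDdegree_def X_def[symmetric] J_def[symmetric] using crit by auto
qed

theorem theorem3p6:
  fixes m n :: nat
  shows "(n = 2 * m + 1 \<and> m \<ge> 1 \<longrightarrow>
            has_EDdegree {1..n} (hypersurface {1..n} (hurwitz_Gamma n)) (8 * m - 3) \<and>
            has_EDdegree {0..n} (hypersurface {0..n} (hurwitz_Gamma_bar n)) (4 * m - 2)) \<and>
         (n = 2 * m \<and> m \<ge> 1 \<longrightarrow>
            has_EDdegree {1..n} (hypersurface {1..n} (hurwitz_Gamma n)) (4 * m - 3) \<and>
            (m \<ge> 2 \<longrightarrow>
              has_EDdegree {0..n} (hypersurface {0..n} (hurwitz_Gamma_bar n)) (8 * m - 6)))"
proof (intro conjI impI)
  assume *: "n = 2 * m \<and> m \<ge> 1"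
  then consider "m = 1" | "m \<ge> 2" by linarith
  then show "has_EDdegree {1..n} (hypersurface {1..n} (hurwitz_Gamma n)) (4 * m - 3)"
  proof cases
    case 1
    then show ?thesis using * EDdegree_nonhomogeneous_two by simp
  next
    case 2
    then show ?thesis using * EDdegree_nonhomogeneous_even by blast
  qed
qed (use EDdegree_nonhomogeneous_odd EDdegree_homogeneous_odd EDdegree_homogeneous_even in blast)+

end
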